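(* Let $(L,\mathcal G)$ be a stable nestoid and let $R=\{f,g_1,\dots,g_k\}$ be a causal region in $\mathcal G$ with maximal element $f$ and pairwise incomparable remaining elements $g_1,\dots,g_k$. Let $\mathcal G^{\lceil R\rceil}$ and $\mathcal G^{\lfloor R\rfloor}$ be as defined in the context and set $\mathcal H:=\mathcal G^{\lfloor R\rfloor}\cup\{f\}$. Then there is an isomorphism of fans $$\mathcal U_{\mathcal G}/\langle w_R\rangle\;\cong\;\Sigma^{2\mathcal G^{\lceil R\rceil}}/\langle f^+,f^-\rangle\times\mathcal U_{\mathcal H}/\langle w_R\rangle ,$$ where $\Sigma^{2\mathcal G^{\lceil R\rceil}}$ is formed with respect to the lattice $[\hat 0,f]$ and $\mathcal U_{\mathcal H}$ with respect to $L$.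
   Context: All lattices are finite. Let $L$ be a lattice with minimum $\hat 0$ and maximum $\hat 1$. A subset $\mathcal G\subseteq L_{>\hat 0}$ is nestable if $\hat 1\in\mathcal G$ and for any two incomparable $f,g\in\mathcal G$, $f\vee g\notin\mathcal G$ implies $f\wedge g=\hat 0$. A subset $N\subseteq\mathcal G$ is nested if for all $k\ge 2$ and pairwise incomparable $f_1,\dots,f_k\in N$ one has $f_1\vee\dots\vee f_k\notin\mathcal G$. $\mathcal N(L,\mathcal G)$ is the simplicial complex of nested sets. $(L,\mathcal G)$ is a nestoid if $\mathcal G$ is nestable and for every $f\in\mathcal G$ the complex $\mathcal N([\hat 0,f],\mathcal G\cap[\hat 0,f])$ is pure. A nestoid is stable if for all $f,g_1,\dots,g_k\in\mathcal G$ with $f\vee g_i\notin\mathcal G$ for all $i$ one has $f\vee g_1\vee\dots\vee g_k\notin\mathcal G$. $\mathbb R^{2\mathcal G}$ is the real vector space with basis $f^+,f^-$ ($f\in\mathcal G$); $p_f,m_f$ are the dual coordinates. For a nested set $N$, $\mathbb R_+^{2N}$ is the cone spanned by $f^+,f^-$, $f\in N$. The fan $\Sigma^{2\mathcal G}$ consists of all faces of the cones $\mathbb R_+^{2N}$, $N\in\mathcal N(L,\mathcal G)$. For $g\in\mathcal G$ put $F_g:=p_{\hat 1}+\sum_{f\in\mathcal G,\ g<f<\hat 1}(p_f-m_f)-m_g$. The causal cone is $\{m_{\hat 1}=0,\ p_g\ge0,\ m_g\ge0,\ F_g\ge 0\ \forall g\in\mathcal G\}$. The universe fan $\mathcal U_{\mathcal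 G}$ is obtained by intersecting the cones of $\Sigma^{2\mathcal G}$ with the causal cone (its cones are these intersections and all their faces). A causal region is a nested set $R=\{r_*,r_1,\dots,r_k\}$ ($k\ge0$) with unique maximal element $r_*$ and $r_1,\dots,r_k$ pairwise incomparable; $w_R:=r_*^++\sum_i r_i^-$. For $f\in\mathcal G$: $\mathcal G^{\lceil f\rceil}:=\{g\in\mathcal G\mid g\le f\}$ and $\mathcal G^{\lfloor f\rfloor}:=\{g\in\mathcal G\mid g>f\text{ or }g\vee f\notin\mathcal G\}$. For a causal region $R$ with maximal element $f$ and other elements $g_1,\dots,g_k$: $\mathcal G^{\lceil R\rceil}$ is obtained from $\mathcal G$ by applying successively $\lceil f\rceil,\lfloor g_1\rfloor,\dots,\lfloor g_k\rfloor$, i.e. $\mathcal G^{\lceil R\rceil}=\{h\in\mathcal G\mid h\le f,\text{ and for each } i:\ h>g_i\text{ or }h\vee g_i\notin\mathcal G\}$; and $\mathcal G^{\lfloor R\rfloor}:=\mathcal G^{\lfloor f\rfloor}\cup\mathcal G^{\lceil g_1\rceil}\cup\dots\cup\mathcal G^{\lceil g_k\rceil}$. ($([\hat 0,f],\mathcal G^{\lceil R\rceil})$ and $(L,\mathcal H)$ are again nestoids.) For a fan $\Sigma$ and a cone $\tau\in\Sigma$ with generators $v_1,\dots,v_r$, $\Sigma/\langle v_1,\dots,v_r\rangle$ denotes the link: the fan in the quotient by $\mathrm{span}(v_1,\dots,v_r)$ consisting of the images of the cones of $\Sigma$ containing $\tau$. An isomorphism of fans is a linear isomorphism between the linear spans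 of their supports that maps the cones of one bijectively onto the cones of the other. *)

theory Defs
  imports "HOL-Analysis.Analysis"
begin

section \<open>Nestoids\<close>

text \<open>
  A finite lattice is a type of sort \<open>{finite, bounded_lattice}\<close>. An interval \<open>[bot, f]\<close> is the
  subset \<open>{..f}\<close>; its joins, meets and minimum are those of the ambient lattice. Nested sets
  of a subset \<open>G\<close> of \<open>{..f}\<close> depend only on \<open>G\<close> and on joins, so they are the same whether
  computed in \<open>{..f}\<close> or in the ambient lattice, and the lattice is not a parameter of
  \<open>nested\<close> and of what is built from it.
\<close>

definition incomparable :: "'a::order \<Rightarrow> 'a \<Rightarrow> bool" where
  "incomparable a b \<longleftrightarrow> \<not> a \<le> b \<and> \<not> b \<le> a"

definition nestable :: "'a::{finite, bounded_lattice} set \<Rightarrow> bool" where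
  "nestable G \<longleftrightarrow> G \<subseteq> {bot<..} \<and> top \<in> G \<and>
     (\<forall>f\<in>G. \<forall>g\<in>G. incomparable f g \<longrightarrow> sup f g \<notin> G \<longrightarrow> inf f g = bot)"

definition nested :: "'a::{finite, bounded_lattice} set \<Rightarrow> 'a set \<Rightarrow> bool" where
  "nested G N \<longleftrightarrow> N \<subseteq> G \<and>
     (\<forall>A\<subseteq>N. card A \<ge> 2 \<longrightarrow> pairwise incomparable A \<longrightarrow> Sup_fin A \<notin> G)"

definition nested_complex :: "'a::{finite, bounded_lattice} set \<Rightarrow> 'a set set" where
  "nested_complex G = {N. nested G N}"

definition pure_complex :: "'a set set \<Rightarrow> bool" where
  "pure_complex K \<longleftrightarrow>
     (\<forall>A\<in>K. \<forall>B\<in>K. (\<forall>C\<in>K. \<not> A \<subset> C) \<longrightarrow> (\<forall>C\<in>K. \<not> B \<subset> C) \<longrightarrow> card A = card B)"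

definition nestoid :: "'a::{finite, bounded_lattice} set \<Rightarrow> bool" where
  "nestoid G \<longleftrightarrow> nestable G \<and> (\<forall>f\<in>G. pure_complex (nested_complex (G \<inter> {..f})))"

definition stable_nestoid :: "'a::{finite, bounded_lattice} set \<Rightarrow> bool" where
  "stable_nestoid G \<longleftrightarrow> nestoid G \<and>
     (\<forall>f\<in>G. \<forall>A\<subseteq>G. A \<noteq> {} \<longrightarrow> (\<forall>g\<in>A. sup f g \<notin> G) \<longrightarrow> Sup_fin (insert f A) \<notin> G)"


section \<open>The fan of nested sets and the universe fan\<close>

text \<open>
  A vector is a pair of families of coordinates: \<open>pcoord x f\<close> is the coordinate of the basis vector
  \<open>plus_vec f\<close> and \<open>mcoord x f\<close> that of \<open>minus_vec f\<close>. The space of \<open>G\<close> is the coordinate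
  subspace \<open>dspace G\<close>, so spaces of different sets share their basis vectors.
\<close>

type_synonym 'a dvec = "(real ^ 'a) \<times> (real ^ 'a)"

definition plus_vec :: "'a::finite \<Rightarrow> 'a dvec" where
  "plus_vec f = (axis f 1, 0)"

definition minus_vec :: "'a::finite \<Rightarrow> 'a dvec" where
  "minus_vec f = (0, axis f 1)"

definition pcoord :: "'a::finite dvec \<Rightarrow> 'a \<Rightarrow> real" where
  "pcoord x f = fst x $ f"

definition mcoord :: "'a::finite dvec \<Rightarrow> 'a \<Rightarrow> real" where
  "mcoord x f = snd x $ f"

definition dspace :: "'a::finite set \<Rightarrow> 'a dvec set" where
  "dspace G = span (plus_vec ` G \<union> minus_vec ` G)"

definition nested_cone :: "'a::finite set \<Rightarrow> 'a dvec set" where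
  "nested_cone N = convex_cone hull (plus_vec ` N \<union> minus_vec ` N)"

text \<open>The empty set is a face in the sense of \<open>face_of\<close>, but not a cone.\<close>

definition nested_fan :: "'a::{finite, bounded_lattice} set \<Rightarrow> 'a dvec set set" where
  "nested_fan G = {\<tau>. \<tau> \<noteq> {} \<and> (\<exists>N\<in>nested_complex G. \<tau> face_of nested_cone N)}"

definition causal_form :: "'a::{finite, bounded_lattice} set \<Rightarrow> 'a \<Rightarrow> 'a dvec \<Rightarrow> real" where
  "causal_form G g x = pcoord x top + (\<Sum>f\<in>{f\<in>G. g < f \<and> f < top}. pcoord x f - mcoord x f) - mcoord x g"

definition causal_cone :: "'a::{finite, bounded_lattice} set \<Rightarrow> 'a dvec set" where
  "causal_cone G = {x \<in> dspace G. mcoord x top = 0 \<and>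
     (\<forall>g\<in>G. pcoord x g \<ge> 0 \<and> mcoord x g \<ge> 0 \<and> causal_form G g x \<ge> 0)}"

definition universe_fan :: "'a::{finite, bounded_lattice} set \<Rightarrow> 'a dvec set set" where
  "universe_fan G = {\<tau>. \<tau> \<noteq> {} \<and> (\<exists>\<sigma>\<in>nested_fan G. \<tau> face_of (\<sigma> \<inter> causal_cone G))}"


section \<open>Causal regions\<close>

definition causal_region :: "'a::{finite, bounded_lattice} set \<Rightarrow> 'a set \<Rightarrow> 'a \<Rightarrow> bool" where
  "causal_region G R f \<longleftrightarrow> nested G R \<and> {r\<in>R. \<forall>s\<in>R. \<not> r < s} = {f} \<and>
     pairwise incomparable (R - {f})"

definition region_vec :: "'a::finite set \<Rightarrow> 'a \<Rightarrow> 'a dvec" where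
  "region_vec R f = plus_vec f + (\<Sum>g\<in>R - {f}. minus_vec g)"

definition restr :: "'a::{finite, bounded_lattice} set \<Rightarrow> 'a \<Rightarrow> 'a set" where
  "restr G f = {g\<in>G. g \<le> f}"

definition contr :: "'a::{finite, bounded_lattice} set \<Rightarrow> 'a \<Rightarrow> 'a set" where
  "contr G f = {g\<in>G. g > f \<or> sup g f \<notin> G}"

definition region_restr :: "'a::{finite, bounded_lattice} set \<Rightarrow> 'a set \<Rightarrow> 'a \<Rightarrow> 'a set" where
  "region_restr G R f = {h\<in>G. h \<le> f \<and> (\<forall>g\<in>R - {f}. h > g \<or> sup h g \<notin> G)}"

definition region_contr :: "'a::{finite, bounded_lattice} set \<Rightarrow> 'a set \<Rightarrow> 'a \<Rightarrow> 'a set" where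
  "region_contr G R f = contr G f \<union> (\<Union>g\<in>R - {f}. restr G g)"


section \<open>Fans in quotient spaces\<close>

text \<open>
  The quotient of a real vector space by a subspace \<open>W\<close> consists of the cosets \<open>x +o W\<close>. Sums
  of cosets are Minkowski sums; \<open>qscale W c\<close> is scalar multiplication, the summand \<open>W\<close> being
  needed for \<open>c = 0\<close>. A fan in the quotient by \<open>W\<close> is a pair of \<open>W\<close> and a set of cones, each
  cone being a set of cosets.
\<close>

type_synonym 'v qfan = "'v set \<times> 'v set set set"

definition qscale :: "'v::real_vector set \<Rightarrow> real \<Rightarrow> 'v set \<Rightarrow> 'v set" where
  "qscale W c A = (\<lambda>x. c *\<^sub>R x) ` A + W"

definition qsubspace :: "'v::real_vector set \<Rightarrow> 'v set set \<Rightarrow> bool" where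
  "qsubspace W S \<longleftrightarrow> S \<subseteq> range (\<lambda>x. x +o W) \<and> W \<in> S \<and>
     (\<forall>A\<in>S. \<forall>B\<in>S. A + B \<in> S) \<and> (\<forall>c. \<forall>A\<in>S. qscale W c A \<in> S)"

definition qspan :: "'v::real_vector set \<Rightarrow> 'v set set \<Rightarrow> 'v set set" where
  "qspan W X = qsubspace W hull X"

text \<open>\<open>link \<Sigma> T\<close> is the link of the cone generated by \<open>T\<close>.\<close>

definition link :: "'v::real_vector set set \<Rightarrow> 'v set \<Rightarrow> 'v qfan" where
  "link \<Sigma> T = (span T, {(\<lambda>x. x +o span T) ` \<sigma> |\<sigma>. \<sigma> \<in> \<Sigma> \<and> convex_cone hull T \<subseteq> \<sigma>})"

text \<open>
  The product of the quotients by \<open>W\<close> and \<open>W'\<close> is the quotient of the product space by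
  \<open>W \<times> W'\<close>: the pair of cosets \<open>A\<close>, \<open>B\<close> is the coset \<open>A \<times> B\<close>.
\<close>

fun fan_prod :: "'v::real_vector qfan \<Rightarrow> 'w::real_vector qfan \<Rightarrow> ('v \<times> 'w) qfan" where
  "fan_prod (W, \<Sigma>) (W', \<Sigma>') = (W \<times> W', {{A \<times> B |A B. A \<in> \<sigma> \<and> B \<in> \<sigma>'} |\<sigma> \<sigma>'. \<sigma> \<in> \<Sigma> \<and> \<sigma>' \<in> \<Sigma>'})"

fun fan_isomorphic :: "'v::real_vector qfan \<Rightarrow> 'w::real_vector qfan \<Rightarrow> bool" where
  "fan_isomorphic (W, \<Sigma>) (W', \<Sigma>') \<longleftrightarrow>
     (\<exists>\<phi>. bij_betw \<phi> (qspan W (\<Union>\<Sigma>)) (qspan W' (\<Union>\<Sigma>')) \<and>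
          (\<forall>A\<in>qspan W (\<Union>\<Sigma>). \<forall>B\<in>qspan W (\<Union>\<Sigma>). \<phi> (A + B) = \<phi> A + \<phi> B) \<and>
          (\<forall>c. \<forall>A\<in>qspan W (\<Union>\<Sigma>). \<phi> (qscale W c A) = qscale W' c (\<phi> A)) \<and>
          bij_betw (\<lambda>\<sigma>. \<phi> ` \<sigma>) \<Sigma> \<Sigma>')"

end

theory Submission
  imports Defs
begin

text \<open>
  Write \<open>A = region_restr G R f\<close>, \<open>S = R - {f}\<close>, \<open>w = region_vec R f\<close>, and \<open>p_h\<close>, \<open>m_h\<close>, \<open>F_g\<close> for the
  coordinates and the causal forms. A cone of the universe fan of \<open>G\<close> that contains \<open>w\<close> is a face of
  the cone of all \<open>x\<close> with nonnegative coordinates supported on a nested set \<open>N \<supseteq> R\<close>, with \<open>m_top = 0\<close>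
  and all \<open>F_g \<ge> 0\<close>. In the quotient by \<open>w\<close>, only those inequalities survive that are equalities at \<open>w\<close>.
  In particular \<open>m_h\<close> is free for \<open>h \<in> S\<close>. For \<open>g \<in> G\<close> the value of \<open>F_g\<close> at \<open>w\<close> is \<open>1\<close> if \<open>g < f\<close> (or
  \<open>f = top\<close>) and \<open>g\<close> is below no element of \<open>S\<close>, and \<open>0\<close> otherwise (lemma \<open>causal_form_w\<close>). So the
  conditions \<open>F_g \<ge> 0\<close> for \<open>g \<in> A - {f}\<close> disappear, and the coordinates in \<open>A - {f}\<close> only have to be
  nonnegative: this is the factor given by the nested fan of \<open>A\<close>. What remains are the coordinates and
  the forms \<open>F_g\<close> with \<open>g \<in> H\<close>. These agree with the forms of \<open>H\<close>, except that for \<open>g\<close> below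
  \<open>h \<in> S\<close> the form of \<open>G\<close> also contains the terms \<open>p_k - m_k\<close> with \<open>k \<in> A\<close> and \<open>h < k < f\<close>. As \<open>m_h\<close> is
  free, their sum can be subtracted from \<open>m_h\<close>, and this linear change of coordinates turns the forms
  of \<open>G\<close> into those of \<open>H\<close> (lemma \<open>causal_form_\<Phi>\<close>).

  For this to give an isomorphism of fans, the nested sets of \<open>G\<close> containing \<open>R\<close> have to be
  the unions of a nested set of \<open>A\<close> containing \<open>f\<close> and a nested set of \<open>H\<close> containing \<open>R\<close>. A nested set
  containing \<open>R\<close> lies in \<open>A \<union> H\<close>, and \<open>A \<inter> H = {f}\<close>. That, conversely, such unions are nested in \<open>G\<close>
  (lemma \<open>nested_Un\<close>) is where stability enters. Typically, if the join of an antichain were in \<open>G\<close>, it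
  could be joined with suitable elements of \<open>R\<close> without leaving \<open>G\<close>, by nestability or by the definition
  of \<open>A\<close>, while stability at one element of \<open>R\<close> shows that the resulting join is outside \<open>G\<close>.

  The cones of a link are images of faces. Faces that contain given vectors \<open>T\<close> can be recovered after
  adding \<open>span T\<close> to the ambient cone, so it suffices to identify the ambient cones
  modulo these spans (lemmas \<open>face_image_mod_span\<close> and \<open>face_preimage_mod_span\<close>). For the cones
  of \<open>G\<close> and the products of cones of \<open>A\<close> and \<open>H\<close> this is lemma \<open>\<Phi>_image_causal_slice\<close>, where large
  multiples of \<open>w\<close> are added to satisfy the inequalities that are strict at \<open>w\<close>.
\<close>

section \<open>Linear maps and fans of cosets\<close>

lemma coset_eq_iff:
  fixes W :: "'v::real_vector set"
  assumes "subspace W"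
  shows "x +o W = y +o W \<longleftrightarrow> x - y \<in> W"
proof
  assume "x +o W = y +o W"
  moreover have "x \<in> x +o W"
    using set_plus_intro2[OF subspace_0[OF assms], of x] by simp
  ultimately show "x - y \<in> W" by (simp add: set_minus_plus)
next
  assume d: "x - y \<in> W"
  have "(x - y) +o W = W"
  proof (rule set_eqI)
    fix z
    show "z \<in> (x - y) +o W \<longleftrightarrow> z \<in> W"
      using subspace_add[OF assms d, of "z - (x - y)"] subspace_diff[OF assms _ d, of z]
      by (auto simp flip: set_minus_plus)
  qed
  then have "y +o ((x - y) +o W) = y +o W" by simp
  then show "x +o W = y +o W" by (simp add: set_plus_rearrange2)
qed

lemma subspace_set_plus_self: "subspace W \<Longrightarrow> W + W = (W :: 'v::real_vector set)"
  by (auto simp: set_plus_def subspace_add) (metis add.left_neutral subspace_0)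

lemma coset_add:
  fixes W :: "'v::real_vector set"
  assumes "subspace W"
  shows "(x +o W) + (y +o W) = (x + y) +o W"
  by (simp add: set_plus_rearrange subspace_set_plus_self[OF assms])

lemma qscale_coset:
  fixes W :: "'v::real_vector set"
  assumes "subspace W"
  shows "qscale W c (x +o W) = (c *\<^sub>R x) +o W"
proof (rule set_eqI)
  fix z
  have "z \<in> qscale W c (x +o W) \<longleftrightarrow> (\<exists>u\<in>W. \<exists>v\<in>W. z = c *\<^sub>R (x + u) + v)"
    by (auto simp: qscale_def set_plus_def elt_set_plus_def)
  also have "\<dots> \<longleftrightarrow> z - c *\<^sub>R x \<in> W"
  proof
    assume "\<exists>u\<in>W. \<exists>v\<in>W. z = c *\<^sub>R (x + u) + v"
    then obtain u v where "u \<in> W" "v \<in> W" "z - c *\<^sub>R x = c *\<^sub>R u + v"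
      by (auto simp: algebra_simps)
    then show "z - c *\<^sub>R x \<in> W"
      using assms by (simp add: subspace_add subspace_scale)
  next
    assume "z - c *\<^sub>R x \<in> W"
    then show "\<exists>u\<in>W. \<exists>v\<in>W. z = c *\<^sub>R (x + u) + v"
      by (intro bexI[of _ 0] bexI[of _ "z - c *\<^sub>R x"]) (auto simp: subspace_0[OF assms])
  qed
  finally show "z \<in> qscale W c (x +o W) \<longleftrightarrow> z \<in> (c *\<^sub>R x) +o W"
    by (simp add: set_minus_plus)
qed

text \<open>
  Subspaces of the quotient by \<open>W\<close> pull back to subspaces along the quotient map, and subspaces push
  forward, so the quotient map commutes with spans.
\<close>

lemma qspan_cosets:
  fixes W :: "'v::real_vector set"
  assumes W: "subspace W"
  shows "qspan W ((\<lambda>x. x +o W) ` X) = (\<lambda>x. x +o W) ` span X" (is "?L = ?R")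
proof
  have "qsubspace W ?R"
    unfolding qsubspace_def
  proof (intro conjI ballI allI)
    show "W \<in> ?R" using span_0[of X] by (metis image_eqI set_zero_plus)
    show "A + B \<in> ?R" if "A \<in> ?R" "B \<in> ?R" for A B
      using that span_add[of _ X] by (auto simp: coset_add[OF W])
    show "qscale W c A \<in> ?R" if "A \<in> ?R" for c A
      using that span_scale[of _ X] by (auto simp: qscale_coset[OF W])
  qed auto
  then show "?L \<subseteq> ?R"
    unfolding qspan_def by (intro hull_minimal image_mono span_superset) auto
  show "?R \<subseteq> ?L"
    unfolding qspan_def hull_def
  proof (intro Inter_greatest)
    fix Q assume "Q \<in> {Q. qsubspace W Q \<and> (\<lambda>x. x +o W) ` X \<subseteq> Q}"
    then have Q: "qsubspace W Q" and X: "X \<subseteq> {x. x +o W \<in> Q}" by auto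
    have "subspace {x. x +o W \<in> Q}"
      using Q unfolding subspace_def qsubspace_def
      by (auto simp flip: coset_add[OF W] qscale_coset[OF W])
    with X have "span X \<subseteq> {x. x +o W \<in> Q}" by (rule span_minimal)
    then show "?R \<subseteq> Q" by auto
  qed
qed

text \<open>
  Equality modulo \<open>W\<close> of sets of vectors is expressed below by Minkowski sums, which avoid sets of
  cosets; this lemma returns to cosets.
\<close>

lemma cosets_eq_if_set_plus_eq:
  fixes W :: "'v::real_vector set"
  assumes W: "subspace W" and eq: "A + W = B + W"
  shows "(\<lambda>x. x +o W) ` A = (\<lambda>x. x +o W) ` B"
proof -
  have "(\<lambda>x. x +o W) ` A \<subseteq> (\<lambda>x. x +o W) ` B" if eq: "A + W = B + W" for A B
  proof safe
    fix a assume "a \<in> A"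
    then have "a + 0 \<in> A + W" using subspace_0[OF W] by (rule set_plus_intro)
    then obtain b w where "a = b + w" "b \<in> B" "w \<in> W" unfolding eq by (auto elim: set_plus_elim)
    then show "a +o W \<in> (\<lambda>x. x +o W) ` B"
      by (intro image_eqI[of _ _ b]) (simp_all add: coset_eq_iff[OF W])
  qed
  from this[OF eq] this[OF eq[symmetric]] show ?thesis by (rule subset_antisym)
qed

text \<open>
  An isomorphism of quotient fans can be given upstairs: a linear map that matches the cones of
  \<open>S\<close> and \<open>S'\<close> modulo \<open>W'\<close> induces a linear map of quotients which is onto the span of the second
  fan. Injectivity is asked for on a subspace \<open>D\<close> that contains the cones of \<open>S\<close>, so the map may
  forget coordinates that vanish on all of them. An induced map that is injective on the span is also
  injective on sets of cosets, hence on cones.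
\<close>

lemma fan_isomorphic_if_linear_correspondence:
  fixes \<Phi> :: "'v::real_vector \<Rightarrow> 'w::real_vector"
  assumes lin: "linear \<Phi>" and W: "subspace W" and W': "subspace W'"
    and D: "subspace D" "\<Union>S \<subseteq> D"
    and into: "\<And>x. x \<in> W \<Longrightarrow> \<Phi> x \<in> W'"
    and inj: "\<And>x. x \<in> D \<Longrightarrow> \<Phi> x \<in> W' \<Longrightarrow> x \<in> W"
    and fwd: "\<And>\<sigma>. \<sigma> \<in> S \<Longrightarrow> \<exists>\<sigma>'\<in>S'. \<Phi> ` \<sigma> + W' = \<sigma>' + W'"
    and bwd: "\<And>\<sigma>'. \<sigma>' \<in> S' \<Longrightarrow> \<exists>\<sigma>\<in>S. \<Phi> ` \<sigma> + W' = \<sigma>' + W'"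
  shows "fan_isomorphic (W, (\<lambda>\<sigma>. (\<lambda>x. x +o W) ` \<sigma>) ` S) (W', (\<lambda>\<sigma>. (\<lambda>x. x +o W') ` \<sigma>) ` S')"
proof -
  let ?q = "\<lambda>x. x +o W" and ?q' = "\<lambda>y. y +o W'"
  let ?\<Sigma> = "(\<lambda>\<sigma>. ?q ` \<sigma>) ` S" and ?\<Sigma>' = "(\<lambda>\<sigma>. ?q' ` \<sigma>) ` S'"
  \<comment> \<open>Adding \<open>W'\<close> turns the image of a coset of \<open>W\<close>, which may be smaller, into a coset of \<open>W'\<close>.\<close>
  define \<phi> where "\<phi> A = \<Phi> ` A + W'" for A
  have \<phi>: "\<phi> (?q x) = ?q' (\<Phi> x)" for x
  proof -
    have "\<Phi> ` W + W' = W'"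
    proof
      show "\<Phi> ` W + W' \<subseteq> W'"
        using into subspace_add[OF W'] by (auto elim!: set_plus_elim)
      have "0 \<in> \<Phi> ` W"
        using subspace_0[OF W] linear_0[OF lin] by (metis imageI)
      then show "W' \<subseteq> \<Phi> ` W + W'" by (rule set_zero_plus2)
    qed
    moreover have "\<Phi> ` (x +o W) = \<Phi> x +o \<Phi> ` W"
      by (force simp: elt_set_plus_def image_iff linear_add[OF lin])
    ultimately show ?thesis by (simp add: \<phi>_def set_plus_rearrange3)
  qed
  have \<phi>_im: "\<phi> ` ?q ` X = ?q' ` \<Phi> ` X" for X
    by (simp add: image_image \<phi>)
  have cones: "(\<lambda>C. \<phi> ` C) ` ?\<Sigma> = ?\<Sigma>'"
  proof -
    have *: "?q' ` \<Phi> ` \<sigma> = ?q' ` \<sigma>'" if "\<Phi> ` \<sigma> + W' = \<sigma>' + W'" for \<sigma> \<sigma>'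
      using cosets_eq_if_set_plus_eq[OF W' that] .
    show ?thesis
    proof (intro subset_antisym subsetI)
      fix C assume "C \<in> (\<lambda>C. \<phi> ` C) ` ?\<Sigma>"
      then obtain \<sigma> where \<sigma>: "\<sigma> \<in> S" "C = \<phi> ` ?q ` \<sigma>" by blast
      then obtain \<sigma>' where \<sigma>': "\<sigma>' \<in> S'" "\<Phi> ` \<sigma> + W' = \<sigma>' + W'" using fwd by blast
      have "C = ?q' ` \<sigma>'" unfolding \<sigma>(2) \<phi>_im by (rule *[OF \<sigma>'(2)])
      then show "C \<in> ?\<Sigma>'" using \<sigma>'(1) by (rule image_eqI)
    next
      fix C assume "C \<in> ?\<Sigma>'"
      then obtain \<sigma>' where C: "\<sigma>' \<in> S'" "C = ?q' ` \<sigma>'" by blast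
      then obtain \<sigma> where \<sigma>: "\<sigma> \<in> S" "\<Phi> ` \<sigma> + W' = \<sigma>' + W'" using bwd by blast
      have "C = \<phi> ` ?q ` \<sigma>" unfolding \<phi>_im C(2) using *[OF \<sigma>(2)] ..
      then show "C \<in> (\<lambda>C. \<phi> ` C) ` ?\<Sigma>" using \<sigma>(1) by (intro image_eqI[OF _ imageI])
    qed
  qed
  have U: "\<Union>?\<Sigma> = ?q ` \<Union>S" "\<Union>?\<Sigma>' = ?q' ` \<Union>S'" by blast+
  have dom: "qspan W (\<Union>?\<Sigma>) = ?q ` span (\<Union>S)"
    unfolding U by (rule qspan_cosets[OF W])
  have ran: "qspan W' (\<Union>?\<Sigma>') = \<phi> ` qspan W (\<Union>?\<Sigma>)"
  proof -
    have "\<Union>?\<Sigma>' = \<phi> ` \<Union>?\<Sigma>" unfolding cones[symmetric] by blast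
    also have "\<dots> = ?q' ` \<Phi> ` \<Union>S" unfolding U by (rule \<phi>_im)
    finally have "qspan W' (\<Union>?\<Sigma>') = ?q' ` span (\<Phi> ` \<Union>S)" by (simp add: qspan_cosets[OF W'])
    also have "\<dots> = \<phi> ` qspan W (\<Union>?\<Sigma>)"
      unfolding dom \<phi>_im linear_span_image[OF lin] ..
    finally show ?thesis .
  qed
  have span_D: "span (\<Union>S) \<subseteq> D" using D by (simp add: span_minimal)
  have inj_\<phi>: "inj_on \<phi> (qspan W (\<Union>?\<Sigma>))"
  proof (rule inj_onI)
    fix A B assume "A \<in> qspan W (\<Union>?\<Sigma>)" "B \<in> qspan W (\<Union>?\<Sigma>)" and eq: "\<phi> A = \<phi> B"
    then obtain x y where xy: "x \<in> span (\<Union>S)" "y \<in> span (\<Union>S)" "A = ?q x" "B = ?q y"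
      unfolding dom by blast
    with eq have "\<Phi> (x - y) \<in> W'"
      by (simp add: \<phi> coset_eq_iff[OF W'] linear_diff[OF lin])
    moreover have "x - y \<in> D" using xy span_D by (blast intro: span_diff)
    ultimately have "x - y \<in> W" by (intro inj)
    then show "A = B" using xy by (simp add: coset_eq_iff[OF W])
  qed
  have "bij_betw \<phi> (qspan W (\<Union>?\<Sigma>)) (qspan W' (\<Union>?\<Sigma>'))"
    using inj_\<phi> ran by (simp add: bij_betw_def)
  moreover have "\<forall>A\<in>qspan W (\<Union>?\<Sigma>). \<forall>B\<in>qspan W (\<Union>?\<Sigma>). \<phi> (A + B) = \<phi> A + \<phi> B"
    unfolding dom by (auto simp: coset_add[OF W] coset_add[OF W'] \<phi> linear_add[OF lin])
  moreover have "\<forall>c. \<forall>A\<in>qspan W (\<Union>?\<Sigma>). \<phi> (qscale W c A) = qscale W' c (\<phi> A)"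
    unfolding dom by (auto simp: qscale_coset[OF W] qscale_coset[OF W'] \<phi> linear_scale[OF lin])
  moreover have "bij_betw (\<lambda>C. \<phi> ` C) ?\<Sigma> ?\<Sigma>'"
    unfolding bij_betw_def
  proof
    have "\<Union>?\<Sigma> \<subseteq> qspan W (\<Union>?\<Sigma>)" unfolding qspan_def by (rule hull_subset)
    then have "?\<Sigma> \<subseteq> Pow (qspan W (\<Union>?\<Sigma>))" by blast
    then show "inj_on (\<lambda>C. \<phi> ` C) ?\<Sigma>"
      by (rule inj_on_subset[OF inj_on_image_Pow[OF inj_\<phi>]])
  qed (rule cones)
  ultimately show ?thesis by (simp only: fan_isomorphic.simps) blast
qed

lemma link_eq: "link \<Sigma> T = (span T, (\<lambda>\<sigma>. (\<lambda>x. x +o span T) ` \<sigma>) ` {\<sigma>\<in>\<Sigma>. convex_cone hull T \<subseteq> \<sigma>})"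
  by (auto simp: link_def)

lemma coset_Times: "((x, y) +o (W \<times> W')) = (x +o W) \<times> (y +o W')"
  by (auto simp: elt_set_plus_def)

lemma fan_prod_cosets:
  "fan_prod (W, (\<lambda>\<sigma>. (\<lambda>x. x +o W) ` \<sigma>) ` S) (W', (\<lambda>\<sigma>. (\<lambda>x. x +o W') ` \<sigma>) ` S') =
     (W \<times> W', (\<lambda>\<sigma>. (\<lambda>x. x +o (W \<times> W')) ` \<sigma>) ` {\<sigma> \<times> \<sigma>' |\<sigma> \<sigma>'. \<sigma> \<in> S \<and> \<sigma>' \<in> S'})"
proof -
  have *: "{A \<times> B |A B. A \<in> (\<lambda>x. x +o W) ` \<sigma> \<and> B \<in> (\<lambda>x. x +o W') ` \<sigma>'} =
      (\<lambda>x. x +o (W \<times> W')) ` (\<sigma> \<times> \<sigma>')" for \<sigma> \<sigma>'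
    by (force simp: coset_Times)
  show ?thesis
    unfolding fan_prod.simps prod.inject
  proof (intro conjI refl set_eqI iffI)
    fix C
    assume "C \<in> {{A \<times> B |A B. A \<in> \<sigma> \<and> B \<in> \<sigma>'} |\<sigma> \<sigma>'.
        \<sigma> \<in> (\<lambda>\<sigma>. (\<lambda>x. x +o W) ` \<sigma>) ` S \<and> \<sigma>' \<in> (\<lambda>\<sigma>. (\<lambda>x. x +o W') ` \<sigma>) ` S'}"
    then obtain \<sigma> \<sigma>' where \<sigma>: "\<sigma> \<in> S" "\<sigma>' \<in> S'"
      and "C = {A \<times> B |A B. A \<in> (\<lambda>x. x +o W) ` \<sigma> \<and> B \<in> (\<lambda>x. x +o W') ` \<sigma>'}" by auto
    then have "C = (\<lambda>x. x +o (W \<times> W')) ` (\<sigma> \<times> \<sigma>')" using * by simp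
    then show "C \<in> (\<lambda>\<sigma>. (\<lambda>x. x +o (W \<times> W')) ` \<sigma>) ` {\<sigma> \<times> \<sigma>' |\<sigma> \<sigma>'. \<sigma> \<in> S \<and> \<sigma>' \<in> S'}"
      using \<sigma> by (intro image_eqI) auto
  next
    fix C
    assume "C \<in> (\<lambda>\<sigma>. (\<lambda>x. x +o (W \<times> W')) ` \<sigma>) ` {\<sigma> \<times> \<sigma>' |\<sigma> \<sigma>'. \<sigma> \<in> S \<and> \<sigma>' \<in> S'}"
    then obtain \<sigma> \<sigma>' where \<sigma>: "\<sigma> \<in> S" "\<sigma>' \<in> S'" "C = (\<lambda>x. x +o (W \<times> W')) ` (\<sigma> \<times> \<sigma>')" by blast
    then show "C \<in> {{A \<times> B |A B. A \<in> \<sigma> \<and> B \<in> \<sigma>'} |\<sigma> \<sigma>'.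
        \<sigma> \<in> (\<lambda>\<sigma>. (\<lambda>x. x +o W) ` \<sigma>) ` S \<and> \<sigma>' \<in> (\<lambda>\<sigma>. (\<lambda>x. x +o W') ` \<sigma>) ` S'}"
      by (intro CollectI exI[of _ "(\<lambda>x. x +o W) ` \<sigma>"] exI[of _ "(\<lambda>x. x +o W') ` \<sigma>'"] conjI imageI)
        (simp_all only: *)
  qed
qed

section \<open>Faces containing a given cone\<close>

text \<open>
  The definition of a face speaks of open segments, hence of distinct end points. The two following
  lemmas speak of convex combinations, whose end points may coincide: these can be moved by linear
  maps that identify points.
\<close>

lemma face_of_combination:
  assumes "F face_of K" "a \<in> K" "b \<in> K" "0 < u" "u < 1" "(1 - u) *\<^sub>R a + u *\<^sub>R b \<in> F"
  shows "a \<in> F" "b \<in> F"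
proof -
  have "a \<in> F \<and> b \<in> F"
  proof (cases "a = b")
    case True
    then show ?thesis using assms(6) by (simp add: algebra_simps)
  next
    case False
    then have "(1 - u) *\<^sub>R a + u *\<^sub>R b \<in> open_segment a b"
      using assms by (auto simp: in_segment)
    then show ?thesis using assms unfolding face_of_def by blast
  qed
  then show "a \<in> F" "b \<in> F" by auto
qed

lemma face_ofI_combination:
  assumes "F \<subseteq> K" "convex F"
    and "\<And>a b u. a \<in> K \<Longrightarrow> b \<in> K \<Longrightarrow> 0 < u \<Longrightarrow> u < 1 \<Longrightarrow> (1 - u) *\<^sub>R a + u *\<^sub>R b \<in> F \<Longrightarrow> a \<in> F \<and> b \<in> F"
  shows "F face_of K"
  unfolding face_of_def
proof (intro conjI ballI impI assms(1,2))
  fix a b x assume "a \<in> K" "b \<in> K" "x \<in> F" "x \<in> open_segment a b"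
  then show "a \<in> F" "b \<in> F" using assms(3) by (auto simp: in_segment)
qed

lemma convex_cone_face:
  assumes "F face_of K" "convex_cone K" "F \<noteq> {}"
  shows "convex_cone F"
  using assms face_of_conic face_of_imp_convex unfolding convex_cone_def by blast

lemma span_obtain_cone_difference:
  assumes "x \<in> span T"
  obtains a b where "a \<in> convex_cone hull T" "b \<in> convex_cone hull T" "x = a - b"
proof -
  let ?C = "convex_cone hull T"
  have cone: "convex_cone ?C" by (rule convex_cone_convex_cone_hull)
  have "subspace {a - b |a b. a \<in> ?C \<and> b \<in> ?C}"
    unfolding subspace_def
  proof (intro conjI allI ballI)
    show "0 \<in> {a - b |a b. a \<in> ?C \<and> b \<in> ?C}"
      using convex_cone_hull_contains_0[of T] by force
  next
    fix x y assume "x \<in> {a - b |a b. a \<in> ?C \<and> b \<in> ?C}" "y \<in> {a - b |a b. a \<in> ?C \<and> b \<in> ?C}"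
    then obtain a b a' b' where "a \<in> ?C" "b \<in> ?C" "a' \<in> ?C" "b' \<in> ?C" "x = a - b" "y = a' - b'"
      by blast
    then have "x + y = (a + a') - (b + b')" "a + a' \<in> ?C" "b + b' \<in> ?C"
      using convex_cone_add[OF cone] by auto
    then show "x + y \<in> {a - b |a b. a \<in> ?C \<and> b \<in> ?C}" by blast
  next
    fix c x assume "x \<in> {a - b |a b. a \<in> ?C \<and> b \<in> ?C}"
    then obtain a b where ab: "a \<in> ?C" "b \<in> ?C" "x = a - b" by blast
    show "c *\<^sub>R x \<in> {a - b |a b. a \<in> ?C \<and> b \<in> ?C}"
    proof (cases "c \<ge> 0")
      case True
      moreover have "c *\<^sub>R x = c *\<^sub>R a - c *\<^sub>R b" unfolding ab(3) by (rule scaleR_diff_right)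
      ultimately show ?thesis using ab convex_cone_scaleR[OF cone True] by blast
    next
      case False
      then have "c *\<^sub>R x = (- c) *\<^sub>R b - (- c) *\<^sub>R a" "0 \<le> - c" using ab by (auto simp: algebra_simps)
      then show ?thesis using ab convex_cone_scaleR[OF cone \<open>0 \<le> - c\<close>] by blast
    qed
  qed
  moreover have "T \<subseteq> {a - b |a b. a \<in> ?C \<and> b \<in> ?C}"
    using convex_cone_hull_contains_0[of T] hull_subset[of T convex_cone] by force
  ultimately have "span T \<subseteq> {a - b |a b. a \<in> ?C \<and> b \<in> ?C}" by (intro span_minimal)
  then show ?thesis using assms that by blast
qed

text \<open>
  The faces of a cone \<open>K\<close> that contain \<open>T\<close> are determined by \<open>K + span T\<close>: enlarging a face by
  \<open>span T\<close> loses nothing, because every element of \<open>span T\<close> is a difference of two elements of the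
  cone over \<open>T\<close>, which lies in the face. Hence two cones which a linear map identifies modulo these
  spans have corresponding faces. The two following lemmas are the two directions of this
  correspondence; the face of \<open>K'\<close> is the part of \<open>K'\<close> over the image of \<open>\<tau>\<close>.
\<close>

lemma face_image_mod_span:
  fixes \<Phi> :: "'v::real_vector \<Rightarrow> 'w::real_vector"
  assumes lin: "linear \<Phi>" and K: "convex_cone K" and K': "convex_cone K'"
    and eq: "\<Phi> ` K + span T' = K' + span T'"
    and into: "\<And>x. x \<in> span T \<Longrightarrow> \<Phi> x \<in> span T'"
    and inj: "\<And>x. x \<in> span K \<Longrightarrow> \<Phi> x \<in> span T' \<Longrightarrow> x \<in> span T"
    and T': "T' \<subseteq> K'"
    and \<tau>: "\<tau> face_of K" "\<tau> \<noteq> {}" "T \<subseteq> \<tau>"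
  shows "\<exists>\<tau>'. \<tau>' face_of K' \<and> \<tau>' \<noteq> {} \<and> T' \<subseteq> \<tau>' \<and> \<Phi> ` \<tau> + span T' = \<tau>' + span T'"
proof -
  let ?W = "span T'"
  define \<tau>' where "\<tau>' = (\<Phi> ` \<tau> + ?W) \<inter> K'"
  have sub: "\<tau> \<subseteq> K" using \<tau>(1) by (rule face_of_imp_subset)
  have cone: "convex_cone \<tau>" using convex_cone_face[OF \<tau>(1) K \<tau>(2)] .
  have hull: "convex_cone hull T \<subseteq> \<tau>" using \<tau>(3) cone by (rule hull_minimal)
  have T\<tau>: "T' \<subseteq> \<tau>'"
  proof
    fix y assume y: "y \<in> T'"
    have "\<Phi> 0 + y \<in> \<Phi> ` \<tau> + ?W"
      using convex_cone_contains_0[OF cone] span_base[OF y] by (intro set_plus_intro imageI)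
    then show "y \<in> \<tau>'" using y T' by (auto simp: \<tau>'_def linear_0[OF lin])
  qed
  have "0 \<in> \<tau>'"
  proof -
    have "\<Phi> 0 + 0 \<in> \<Phi> ` \<tau> + ?W"
      using convex_cone_contains_0[OF cone] span_0 by (intro set_plus_intro imageI)
    then show ?thesis using convex_cone_contains_0[OF K'] by (simp add: \<tau>'_def linear_0[OF lin])
  qed
  have eq\<tau>: "\<Phi> ` \<tau> + ?W = \<tau>' + ?W"
  proof
    show "\<Phi> ` \<tau> + ?W \<subseteq> \<tau>' + ?W"
    proof
      fix y assume "y \<in> \<Phi> ` \<tau> + ?W"
      then obtain x v where x: "x \<in> \<tau>" "v \<in> ?W" "y = \<Phi> x + v" by (auto elim: set_plus_elim)
      have "\<Phi> x + 0 \<in> \<Phi> ` K + ?W" using x sub span_0 by (intro set_plus_intro) auto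
      then obtain k v' where k: "k \<in> K'" "v' \<in> ?W" "\<Phi> x = k + v'"
        unfolding eq by (auto elim: set_plus_elim)
      have "\<Phi> x + - v' \<in> \<Phi> ` \<tau> + ?W"
        using x(1) span_neg[OF k(2)] by (intro set_plus_intro imageI)
      then have "k \<in> \<tau>'" using k by (simp add: \<tau>'_def)
      then have "k + (v' + v) \<in> \<tau>' + ?W" using k x span_add by (intro set_plus_intro) auto
      then show "y \<in> \<tau>' + ?W" using k x by (simp add: add.assoc)
    qed
    have "\<tau>' + ?W \<subseteq> (\<Phi> ` \<tau> + ?W) + ?W"
      unfolding \<tau>'_def by (intro set_plus_mono2 Int_lower1 order_refl)
    then show "\<tau>' + ?W \<subseteq> \<Phi> ` \<tau> + ?W"
      by (simp only: add.assoc subspace_set_plus_self[OF subspace_span])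
  qed
  have "\<tau>' face_of K'"
  proof (rule face_ofI_combination)
    show "\<tau>' \<subseteq> K'" by (simp add: \<tau>'_def)
    show "convex \<tau>'"
      unfolding \<tau>'_def
      using cone K' subspace_imp_convex[OF subspace_span, of T']
      by (intro convex_Int convex_set_plus convex_linear_image lin) (auto simp: convex_cone_def)
  next
    fix a b :: 'w and u :: real
    assume ab: "a \<in> K'" "b \<in> K'" "0 < u" "u < 1" "(1 - u) *\<^sub>R a + u *\<^sub>R b \<in> \<tau>'"
    have "a + 0 \<in> \<Phi> ` K + ?W" "b + 0 \<in> \<Phi> ` K + ?W"
      unfolding eq using ab span_0 by (auto intro!: set_plus_intro simp del: add_0_right)
    then obtain a0 \<alpha> b0 \<beta> where a0: "a0 \<in> K" "\<alpha> \<in> ?W" "a = \<Phi> a0 + \<alpha>"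
      and b0: "b0 \<in> K" "\<beta> \<in> ?W" "b = \<Phi> b0 + \<beta>"
      by (auto elim!: set_plus_elim)
    obtain c0 \<gamma> where c0: "c0 \<in> \<tau>" "\<gamma> \<in> ?W" "(1 - u) *\<^sub>R a + u *\<^sub>R b = \<Phi> c0 + \<gamma>"
      using ab(5) by (auto simp: \<tau>'_def elim!: set_plus_elim)
    \<comment> \<open>The relation between \<open>a\<close>, \<open>b\<close> and the point of the face lifts to \<open>K\<close> up to an element
      of \<open>span T\<close>, which the cone over \<open>T\<close> absorbs.\<close>
    define d where "d = c0 - ((1 - u) *\<^sub>R a0 + u *\<^sub>R b0)"
    have "\<Phi> d = (1 - u) *\<^sub>R \<alpha> + u *\<^sub>R \<beta> - \<gamma>"
    proof -
      have "\<Phi> d = \<Phi> c0 - ((1 - u) *\<^sub>R \<Phi> a0 + u *\<^sub>R \<Phi> b0)"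
        by (simp add: d_def linear_diff[OF lin] linear_add[OF lin] linear_scale[OF lin])
      also have "\<Phi> c0 = (1 - u) *\<^sub>R a + u *\<^sub>R b - \<gamma>" using c0 by simp
      finally show ?thesis unfolding a0 b0 by (simp add: algebra_simps)
    qed
    then have "\<Phi> d \<in> ?W" using a0 b0 c0 by (simp add: span_add span_diff span_scale)
    moreover have "d \<in> span K"
      unfolding d_def using a0 b0 c0 sub by (intro span_diff span_add span_scale span_base) auto
    ultimately have "d \<in> span T" by (intro inj)
    then obtain d1 d2 where d: "d1 \<in> convex_cone hull T" "d2 \<in> convex_cone hull T" "d = d1 - d2"
      by (rule span_obtain_cone_difference)
    have "(1 - u) *\<^sub>R (a0 + d1) + u *\<^sub>R (b0 + d1) = c0 + d2"
      using d(3) unfolding d_def by (simp add: algebra_simps)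
    also have "\<dots> \<in> \<tau>" using c0 d hull by (intro convex_cone_add[OF cone]) auto
    finally have comb: "(1 - u) *\<^sub>R (a0 + d1) + u *\<^sub>R (b0 + d1) \<in> \<tau>" .
    have "a0 + d1 \<in> K" "b0 + d1 \<in> K" using a0 b0 d hull sub by (auto intro: convex_cone_add[OF K])
    from face_of_combination[OF \<tau>(1) this ab(3,4) comb]
    have m: "a0 + d1 \<in> \<tau>" "b0 + d1 \<in> \<tau>" by auto
    have \<Phi>d1: "\<Phi> d1 \<in> ?W"
      using d hull_minimal[of T "span T" convex_cone, OF span_superset convex_cone_span] by (intro into) auto
    have "\<Phi> (a0 + d1) + (\<alpha> - \<Phi> d1) \<in> \<Phi> ` \<tau> + ?W" "\<Phi> (b0 + d1) + (\<beta> - \<Phi> d1) \<in> \<Phi> ` \<tau> + ?W"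
      using m span_diff[OF a0(2) \<Phi>d1] span_diff[OF b0(2) \<Phi>d1] by (blast intro: set_plus_intro)+
    then show "a \<in> \<tau>' \<and> b \<in> \<tau>'"
      using ab a0 b0 by (simp add: \<tau>'_def linear_add[OF lin])
  qed
  then show ?thesis using T\<tau> \<open>0 \<in> \<tau>'\<close> eq\<tau> by blast
qed

text \<open>
  In this direction the face of \<open>K\<close> is the preimage of \<open>\<tau>' + span T'\<close>, and the differences in
  \<open>span T'\<close> that arise from choosing representatives in \<open>K'\<close> are absorbed by the cone over \<open>T'\<close>.
\<close>

lemma face_preimage_mod_span:
  fixes \<Phi> :: "'v::real_vector \<Rightarrow> 'w::real_vector"
  assumes lin: "linear \<Phi>" and K: "convex_cone K" and K': "convex_cone K'"
    and eq: "\<Phi> ` K + span T' = K' + span T'"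
    and into: "\<And>x. x \<in> span T \<Longrightarrow> \<Phi> x \<in> span T'"
    and T: "T \<subseteq> K"
    and \<tau>': "\<tau>' face_of K'" "\<tau>' \<noteq> {}" "T' \<subseteq> \<tau>'"
  shows "\<exists>\<tau>. \<tau> face_of K \<and> \<tau> \<noteq> {} \<and> T \<subseteq> \<tau> \<and> \<Phi> ` \<tau> + span T' = \<tau>' + span T'"
proof -
  let ?W = "span T'"
  define \<tau> where "\<tau> = {x \<in> K. \<Phi> x \<in> \<tau>' + ?W}"
  have sub: "\<tau>' \<subseteq> K'" using \<tau>'(1) by (rule face_of_imp_subset)
  have cone: "convex_cone \<tau>'" using convex_cone_face[OF \<tau>'(1) K' \<tau>'(2)] .
  have hull: "convex_cone hull T' \<subseteq> \<tau>'" using \<tau>'(3) cone by (rule hull_minimal)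
  have W\<tau>: "?W \<subseteq> \<tau>' + ?W" using convex_cone_contains_0[OF cone] by (rule set_zero_plus2)
  have absorb: "y + v \<in> \<tau>' + ?W" if "y \<in> \<tau>' + ?W" "v \<in> ?W" for y v
    using set_plus_intro[OF that]
    by (simp only: add.assoc subspace_set_plus_self[OF subspace_span])
  have conv: "convex (\<tau>' + ?W)"
    using cone subspace_imp_convex[OF subspace_span, of T']
    by (intro convex_set_plus) (auto simp: convex_cone_def)
  have T\<tau>: "T \<subseteq> \<tau>"
    using T W\<tau> into span_base[of _ T] by (auto simp: \<tau>_def)
  have "0 \<in> \<tau>"
    using convex_cone_contains_0[OF K] W\<tau> span_0[of T'] by (auto simp: \<tau>_def linear_0[OF lin])
  have "\<Phi> ` \<tau> + ?W = \<tau>' + ?W"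
  proof
    show "\<Phi> ` \<tau> + ?W \<subseteq> \<tau>' + ?W"
      using absorb unfolding \<tau>_def set_plus_def[of "\<Phi> ` _"] by blast
    show "\<tau>' + ?W \<subseteq> \<Phi> ` \<tau> + ?W"
    proof
      fix y assume "y \<in> \<tau>' + ?W"
      then obtain k v where k: "k \<in> \<tau>'" "v \<in> ?W" "y = k + v" by (auto elim: set_plus_elim)
      have "k + 0 \<in> \<Phi> ` K + ?W" unfolding eq using k sub span_0 by (intro set_plus_intro) auto
      then obtain x v' where x: "x \<in> K" "v' \<in> ?W" "k = \<Phi> x + v'" by (auto elim!: set_plus_elim)
      have "k + - v' \<in> \<tau>' + ?W" using k x span_neg by (intro set_plus_intro) auto
      then have "x \<in> \<tau>" using x by (simp add: \<tau>_def)
      then have "\<Phi> x + (v' + v) \<in> \<Phi> ` \<tau> + ?W" using x k span_add by (intro set_plus_intro) auto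
      then show "y \<in> \<Phi> ` \<tau> + ?W" using x k by (simp add: add.assoc)
    qed
  qed
  moreover have "\<tau> face_of K"
  proof (rule face_ofI_combination)
    show "\<tau> \<subseteq> K" by (auto simp: \<tau>_def)
    have "\<tau> = K \<inter> \<Phi> -` (\<tau>' + ?W)" by (auto simp: \<tau>_def)
    then show "convex \<tau>"
      using K conv by (simp add: convex_Int convex_linear_vimage lin convex_cone_def)
  next
    fix a b :: 'v and u :: real
    assume ab: "a \<in> K" "b \<in> K" "0 < u" "u < 1" "(1 - u) *\<^sub>R a + u *\<^sub>R b \<in> \<tau>"
    have "\<Phi> a + 0 \<in> K' + ?W" "\<Phi> b + 0 \<in> K' + ?W"
      unfolding eq[symmetric] using ab span_0 by (auto intro!: set_plus_intro simp del: add_0_right)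
    then obtain a' \<alpha> b' \<beta> where a': "a' \<in> K'" "\<alpha> \<in> ?W" "\<Phi> a = a' + \<alpha>"
      and b': "b' \<in> K'" "\<beta> \<in> ?W" "\<Phi> b = b' + \<beta>"
      by (auto elim!: set_plus_elim)
    obtain c' \<gamma> where c': "c' \<in> \<tau>'" "\<gamma> \<in> ?W" "(1 - u) *\<^sub>R \<Phi> a + u *\<^sub>R \<Phi> b = c' + \<gamma>"
      using ab(5) by (auto simp: \<tau>_def linear_add[OF lin] linear_scale[OF lin] elim!: set_plus_elim)
    have "c' - ((1 - u) *\<^sub>R a' + u *\<^sub>R b') = (1 - u) *\<^sub>R \<alpha> + u *\<^sub>R \<beta> - \<gamma>"
      using c'(3) unfolding a' b' by (simp add: algebra_simps)
    also have "\<dots> \<in> ?W" using a' b' c' by (simp add: span_add span_diff span_scale)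
    finally obtain d1 d2 where d: "d1 \<in> convex_cone hull T'" "d2 \<in> convex_cone hull T'"
      "c' - ((1 - u) *\<^sub>R a' + u *\<^sub>R b') = d1 - d2"
      by (rule span_obtain_cone_difference)
    have "(1 - u) *\<^sub>R (a' + d1) + u *\<^sub>R (b' + d1) = c' + d2"
      using d(3) by (simp add: algebra_simps)
    also have "\<dots> \<in> \<tau>'" using c' d hull by (intro convex_cone_add[OF cone]) auto
    finally have comb: "(1 - u) *\<^sub>R (a' + d1) + u *\<^sub>R (b' + d1) \<in> \<tau>'" .
    have "a' + d1 \<in> K'" "b' + d1 \<in> K'" using a' b' d hull sub by (auto intro: convex_cone_add[OF K'])
    from face_of_combination[OF \<tau>'(1) this ab(3,4) comb]
    have m: "a' + d1 \<in> \<tau>'" "b' + d1 \<in> \<tau>'" by auto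
    have d1W: "d1 \<in> ?W" using d hull_minimal[of T' "span T'" convex_cone, OF span_superset convex_cone_span] by auto
    have "(a' + d1) + (\<alpha> - d1) \<in> \<tau>' + ?W" "(b' + d1) + (\<beta> - d1) \<in> \<tau>' + ?W"
      using m span_diff[OF a'(2) d1W] span_diff[OF b'(2) d1W] by (blast intro: set_plus_intro)+
    then show "a \<in> \<tau> \<and> b \<in> \<tau>" using ab a' b' by (simp add: \<tau>_def)
  qed
  ultimately show ?thesis using T\<tau> \<open>0 \<in> \<tau>\<close> by blast
qed

section \<open>Nested sets around a causal region\<close>

lemma nested_subset: "nested G N \<Longrightarrow> M \<subseteq> N \<Longrightarrow> nested G M"
  unfolding nested_def by blast

lemma nested_of_subset: "nested G N \<Longrightarrow> N \<subseteq> H \<Longrightarrow> H \<subseteq> G \<Longrightarrow> nested H N"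
  unfolding nested_def by blast

lemma nested_pair:
  assumes "nested G N" "a \<in> N" "b \<in> N" "incomparable a b"
  shows "sup a b \<notin> G"
proof -
  have "a \<noteq> b" "incomparable b a" using assms(4) by (auto simp: incomparable_def)
  then have "pairwise incomparable {a, b}" "card {a, b} \<ge> 2"
    using assms(4) by (auto simp: pairwise_insert)
  then show ?thesis using assms(1-3) unfolding nested_def by (auto dest!: spec[of _ "{a, b}"])
qed

text \<open>
  The nestability axiom in the form in which it is used: two elements of \<open>G\<close> with a common lower
  bound in \<open>G\<close> have a meet different from the minimum, so their join stays in \<open>G\<close>.
\<close>

lemma nestable_sup_in_if_common_lower_bound:
  assumes "nestable G" "a \<in> G" "b \<in> G" "c \<le> a" "c \<le> b" "c \<in> G"
  shows "sup a b \<in> G"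
proof (cases "incomparable a b")
  case True
  moreover have "inf a b \<noteq> bot"
  proof
    assume "inf a b = bot"
    then have "c \<le> bot" using le_inf_iff[of c a b] assms(4,5) by simp
    then show False using assms(1,6) by (auto simp: nestable_def bot_unique)
  qed
  ultimately show ?thesis using assms(1-3) unfolding nestable_def by blast
next
  case False
  then show ?thesis using assms(2,3) by (auto simp: incomparable_def sup_absorb1 sup_absorb2)
qed

text \<open>
  Elements of \<open>G\<close> that share a lower bound with \<open>s\<close> can be joined to \<open>s\<close> one at a time: the growing
  join keeps the common lower bound.
\<close>

lemma nestable_join_of_elements_above:
  assumes "nestable G" "s \<in> G" "finite J" "J \<subseteq> G" "\<And>j. j \<in> J \<Longrightarrow> \<exists>c\<in>G. c \<le> s \<and> c \<le> j"
  shows "Sup_fin (insert s J) \<in> G"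
  using assms(3-5)
proof (induction J)
  case empty
  then show ?case using assms(2) by simp
next
  case (insert j J)
  then have IH: "Sup_fin (insert s J) \<in> G" by blast
  obtain c where c: "c \<in> G" "c \<le> s" "c \<le> j" using insert.prems by blast
  have "c \<le> Sup_fin (insert s J)"
    using c insert.hyps by (intro order.trans[OF c(2)] Sup_fin.coboundedI) auto
  then have "sup j (Sup_fin (insert s J)) \<in> G"
    using nestable_sup_in_if_common_lower_bound[OF assms(1) _ IH c(3) _ c(1)] insert.prems by blast
  moreover have "Sup_fin (insert s (insert j J)) = sup j (Sup_fin (insert s J))"
    using insert.hyps Sup_fin.insert[of "insert s J" j] by (simp add: insert_commute)
  ultimately show ?case by simp
qed

lemma Sup_fin_eq_if_mutually_bounded:
  fixes A B :: "'a::{finite,lattice} set"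
  assumes "A \<noteq> {}" "B \<noteq> {}" "\<And>a. a \<in> A \<Longrightarrow> a \<le> Sup_fin B" "\<And>b. b \<in> B \<Longrightarrow> b \<le> Sup_fin A"
  shows "Sup_fin A = Sup_fin B"
  using assms by (intro antisym Sup_fin.boundedI) auto

locale stable_causal_region =
  fixes G R :: "'a::{finite, bounded_lattice} set" and f :: 'a
  assumes stable: "stable_nestoid G" and region: "causal_region G R f"
begin

text \<open>
  \<open>A\<close> and \<open>H\<close> index the two factors of the decomposition; \<open>S\<close> consists of the elements of the
  region other than its maximum.
\<close>

definition A where "A = region_restr G R f"
definition H where "H = region_contr G R f \<union> {f}"
definition S where "S = R - {f}"

lemma nestable: "nestable G"
  using stable by (simp add: stable_nestoid_def nestoid_def)

lemma stability:
  assumes "a \<in> G" "B \<subseteq> G" "B \<noteq> {}" "\<And>b. b \<in> B \<Longrightarrow> sup a b \<notin> G"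
  shows "Sup_fin (insert a B) \<notin> G"
  using assms stable by (simp add: stable_nestoid_def)

lemma stability_sup:
  assumes "a \<in> G" "B \<subseteq> G" "B \<noteq> {}" "\<And>b. b \<in> B \<Longrightarrow> sup a b \<notin> G"
  shows "sup a (Sup_fin B) \<notin> G"
  using stability[OF assms] assms(3) by simp

lemma nested_R: "nested G R" and f_in_R: "f \<in> R" and R_subset: "R \<subseteq> G" and f_in_G: "f \<in> G"
  and S_subset: "S \<subseteq> G" and S_incomparable: "pairwise incomparable S"
  using region by (auto simp: causal_region_def nested_def S_def)

lemma S_less_f: "g \<in> S \<Longrightarrow> g < f"
proof -
  assume g: "g \<in> S"
  have "finite {r\<in>R. g \<le> r}" "{r\<in>R. g \<le> r} \<noteq> {}" using g by (auto simp: S_def)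
  from finite_has_maximal[OF this] obtain m where
    m: "m \<in> R" "g \<le> m" "\<And>r. r \<in> R \<Longrightarrow> g \<le> r \<Longrightarrow> m \<le> r \<Longrightarrow> m = r" by auto
  then have "\<forall>r\<in>R. \<not> m < r" by (metis order.trans less_le)
  then have "m = f" using m region by (auto simp: causal_region_def)
  then show "g < f" using m g by (auto simp: S_def less_le)
qed

lemma R_iff: "r \<in> R \<longleftrightarrow> r = f \<or> r \<in> S" using f_in_R by (auto simp: S_def)

text \<open>
  Two elements of \<open>S\<close> above a common element of \<open>G\<close> would have their join in \<open>G\<close>, although \<open>R\<close> is
  nested.
\<close>

lemma below_S_unique: "g \<in> G \<Longrightarrow> h \<in> S \<Longrightarrow> h' \<in> S \<Longrightarrow> g \<le> h \<Longrightarrow> g \<le> h' \<Longrightarrow> h = h'"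
  using nestable_sup_in_if_common_lower_bound[OF nestable, of h h' g] nested_pair[OF nested_R, of h h']
    S_subset S_incomparable by (auto simp: pairwise_def S_def)

lemma A_iff: "h \<in> A \<longleftrightarrow> h \<in> G \<and> h \<le> f \<and> (\<forall>g\<in>S. g < h \<or> sup h g \<notin> G)"
  by (auto simp: A_def region_restr_def S_def)

lemma H_iff: "h \<in> H \<longleftrightarrow> h \<in> G \<and> (f \<le> h \<or> sup h f \<notin> G \<or> (\<exists>g\<in>S. h \<le> g))"
  using f_in_G by (auto simp: H_def region_contr_def contr_def restr_def S_def)

lemma A_subset: "A \<subseteq> G" and H_subset: "H \<subseteq> G" by (auto simp: A_iff H_iff)

lemma f_in_A: "f \<in> A" using f_in_G S_less_f by (auto simp: A_iff)

lemma R_subset_H: "R \<subseteq> H"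
proof
  fix r assume "r \<in> R"
  moreover have "r \<in> H" if "r \<in> S" using that S_subset by (auto simp: H_iff)
  ultimately show "r \<in> H" using f_in_G by (auto simp: R_iff H_iff)
qed

lemma top_in_H: "top \<in> H" using nestable by (auto simp: H_iff nestable_def)

lemma A_Int_H: "A \<inter> H = {f}"
proof -
  have "h = f" if "h \<in> A" "h \<in> H" for h
  proof -
    have h: "h \<in> G" "h \<le> f" "\<And>g. g \<in> S \<Longrightarrow> \<not> h \<le> g"
      using that(1) by (auto simp: A_iff sup_absorb2 S_subset[THEN subsetD])
    then have "f \<le> h" using that(2) f_in_G by (auto simp: H_iff sup_absorb2)
    then show "h = f" using h by simp
  qed
  then show ?thesis using f_in_A R_subset_H f_in_R by auto
qed

text \<open>
  An element of a nested set containing \<open>R\<close> has a join outside \<open>G\<close> with each element of \<open>R\<close> that is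
  incomparable to it. So it belongs to \<open>A\<close> if it lies below \<open>f\<close> and below no element of \<open>S\<close>, and to \<open>H\<close>
  otherwise.
\<close>

lemma nested_subset_A_Un_H:
  assumes N: "nested G N" "R \<subseteq> N"
  shows "N \<subseteq> A \<union> H"
proof
  fix h assume h: "h \<in> N"
  then have "h \<in> G" using N by (auto simp: nested_def)
  have "sup h g \<notin> G" if "g \<in> R" "\<not> h \<le> g" "\<not> g \<le> h" for g
    using that h N by (intro nested_pair[OF N(1)]) (auto simp: incomparable_def)
  note out = this
  show "h \<in> A \<union> H"
  proof (cases "h \<le> f \<and> \<not> (\<exists>g\<in>S. h \<le> g)")
    case True
    have "g < h \<or> sup h g \<notin> G" if "g \<in> S" for g
      using out[of g] that True by (auto simp: R_iff less_le)
    then have "h \<in> A" using \<open>h \<in> G\<close> True by (simp add: A_iff)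
    then show ?thesis ..
  next
    case False
    then have "h \<in> H" using \<open>h \<in> G\<close> out[OF f_in_R] by (auto simp: H_iff)
    then show ?thesis ..
  qed
qed

lemma sup_join_notin_if_sups_notin:
  assumes "B \<subseteq> G" "B \<noteq> {}" "\<And>b. b \<in> B \<Longrightarrow> sup b f \<notin> G"
  shows "sup (Sup_fin B) f \<notin> G"
  using stability_sup[OF f_in_G assms(1,2)] assms(3) by (simp add: sup_commute)

text \<open>
  Suppose that the join of \<open>B\<close> lies in \<open>G\<close>. If \<open>B \<subseteq> A\<close>, it is not in \<open>A\<close>, so it fails the defining
  condition of \<open>A\<close> at some \<open>g \<in> S\<close>; since no element of \<open>B\<close> lies above \<open>g\<close>, they all have a join with
  \<open>g\<close> outside \<open>G\<close>, and stability extends this to their common join. If \<open>B\<close> has elements below \<open>S\<close>,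
  joining the elements of \<open>S\<close> above them to the join of \<open>B\<close> stays in \<open>G\<close>. The result is the join of one
  \<open>g \<in> S\<close> with elements of \<open>A\<close> and other elements of \<open>S\<close>, each of which has a join with \<open>g\<close> outside \<open>G\<close>,
  contradicting stability.
\<close>

lemma join_outside_if_below_f:
  assumes B: "B \<subseteq> A \<union> {h\<in>G. \<exists>g\<in>S. h \<le> g}" "B \<inter> A - {f} \<noteq> {}" "f \<notin> B"
    and inc: "pairwise incomparable B" and C: "B \<subseteq> A \<Longrightarrow> Sup_fin B \<notin> A"
  shows "Sup_fin B \<notin> G"
proof
  assume s: "Sup_fin B \<in> G"
  have BG: "B \<subseteq> G" using B A_subset by auto
  have ne: "B \<noteq> {}" using B by auto
  have s_ge: "b \<le> Sup_fin B" if "b \<in> B" for b using that by (simp add: Sup_fin.coboundedI)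
  show False
  proof (cases "B \<subseteq> A")
    case True
    have "Sup_fin B \<le> f" using True ne by (intro Sup_fin.boundedI) (auto simp: A_iff)
    then obtain g where g: "g \<in> S" "\<not> g < Sup_fin B" "sup (Sup_fin B) g \<in> G"
      using C[OF True] s by (auto simp: A_iff)
    have "sup g b \<notin> G" if "b \<in> B" for b
    proof -
      have "\<not> g < b" using g s_ge[OF that] by auto
      moreover have "b \<in> A" using True that by blast
      ultimately have "sup b g \<notin> G" using g(1) A_iff by blast
      then show ?thesis by (simp add: sup_commute)
    qed
    from stability_sup[OF _ BG ne this] g S_subset show False by (auto simp: sup_commute)
  next
    case False
    \<comment> \<open>Replacing the elements below \<open>S\<close> by the elements of \<open>S\<close> above them does not leave \<open>G\<close>.\<close>
    define J where "J = {g\<in>S. \<exists>b\<in>B. b \<le> g}"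
    obtain g where g: "g \<in> J" using False B by (auto simp: J_def)
    have J: "J \<subseteq> G" "J \<subseteq> S" using S_subset by (auto simp: J_def)
    have t: "Sup_fin (insert (Sup_fin B) J) \<in> G"
      using J BG s_ge by (intro nestable_join_of_elements_above[OF nestable s]) (auto simp: J_def)
    define E where "E = (B \<inter> A) \<union> (J - {g})"
    have "Sup_fin (insert (Sup_fin B) J) = Sup_fin (insert g E)"
    proof (rule Sup_fin_eq_if_mutually_bounded)
      have up: "x \<le> Sup_fin (insert g E)" if "x \<in> insert g E" for x
        using that by (intro Sup_fin.coboundedI) auto
      have "b \<le> Sup_fin (insert g E)" if b: "b \<in> B" for b
      proof (cases "b \<in> A")
        case True
        then show ?thesis using b by (intro up) (auto simp: E_def)
      next
        case False
        then obtain h where "h \<in> J" "b \<le> h" using B(1) b unfolding J_def by blast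
        moreover have "h \<le> Sup_fin (insert g E)" using \<open>h \<in> J\<close> by (intro up) (auto simp: E_def)
          ultimately show ?thesis by (blast intro: order.trans)
      qed
      then have "Sup_fin B \<le> Sup_fin (insert g E)" using ne by (intro Sup_fin.boundedI) auto
      then show "x \<le> Sup_fin (insert g E)" if "x \<in> insert (Sup_fin B) J" for x
        using that up[of x] by (auto simp: E_def)
      fix x assume "x \<in> insert g E"
      then consider "x \<in> B" | "x \<in> J" using g by (auto simp: E_def)
      then show "x \<le> Sup_fin (insert (Sup_fin B) J)"
      proof cases
        case 1
        have "Sup_fin B \<le> Sup_fin (insert (Sup_fin B) J)" by (intro Sup_fin.coboundedI) auto
        then show ?thesis using s_ge[OF 1] by (rule order.trans[rotated])
      next
        case 2
        then show ?thesis by (intro Sup_fin.coboundedI) auto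
      qed
    qed auto
    moreover have "Sup_fin (insert g E) \<notin> G"
    proof (rule stability)
      show "g \<in> G" "E \<subseteq> G" "E \<noteq> {}" using g J BG B by (auto simp: E_def)
      fix x assume "x \<in> E"
      then consider "x \<in> B" "x \<in> A" | "x \<in> J" "x \<noteq> g" by (auto simp: E_def)
      then show "sup g x \<notin> G"
      proof cases
        case 1
        obtain b where b: "b \<in> B" "b \<le> g" using g by (auto simp: J_def)
        have "\<not> g < x"
        proof
          assume "g < x"
          then have "b \<noteq> x" "b \<le> x" using b by auto
          then show False using inc b 1 unfolding pairwise_def incomparable_def by blast
        qed
        then show ?thesis using 1 g J by (auto simp: A_iff sup_commute)
      next
        case 2
        then have "g \<in> S" "x \<in> S" using g J by auto
        moreover from this have "incomparable g x"
          using 2 S_incomparable unfolding pairwise_def by metis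
        ultimately show ?thesis by (intro nested_pair[OF nested_R]) (auto simp: R_iff)
      qed
    qed
    ultimately show False using t by simp
  qed
qed

text \<open>
  As before, joining the elements of \<open>S\<close> above elements of \<open>B\<close> to the join of \<open>B\<close> does not leave \<open>G\<close>.
  The result is a join of elements of the nested set \<open>R\<close>, so only one element of \<open>S\<close> is involved; but
  then the join of \<open>B\<close> lies below it and hence in \<open>H\<close>.
\<close>

lemma join_outside_if_below_S:
  assumes B: "B \<subseteq> {h\<in>G. \<exists>g\<in>S. h \<le> g}" "B \<noteq> {}" and C: "Sup_fin B \<notin> H"
  shows "Sup_fin B \<notin> G"
proof
  assume s: "Sup_fin B \<in> G"
  have s_ge: "b \<le> Sup_fin B" if "b \<in> B" for b using that by (simp add: Sup_fin.coboundedI)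
  define J where "J = {g\<in>S. \<exists>b\<in>B. b \<le> g}"
  have J: "J \<subseteq> G" "J \<subseteq> R" "J \<subseteq> S" using S_subset R_iff by (auto simp: J_def)
  have below: "\<exists>g\<in>J. b \<le> g" if "b \<in> B" for b using that B by (auto simp: J_def)
  then have J0: "J \<noteq> {}" using B(2) by auto
  have t: "Sup_fin (insert (Sup_fin B) J) \<in> G"
    using J B s_ge by (intro nestable_join_of_elements_above[OF nestable s]) (auto simp: J_def)
  have bound: "Sup_fin B \<le> Sup_fin J"
  proof (intro Sup_fin.boundedI B(2) finite)
    fix b assume "b \<in> B"
    then obtain g where "g \<in> J" "b \<le> g" using below by blast
    then show "b \<le> Sup_fin J" by (blast intro: order.trans Sup_fin.coboundedI finite)
  qed
  have "card J \<ge> 2"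
  proof (rule ccontr)
    assume "\<not> card J \<ge> 2"
    moreover have "card J > 0" using J0 by (simp add: card_gt_0_iff)
    ultimately have "card J = 1" by simp
    then obtain g where "J = {g}" by (rule card_1_singletonE)
    then have "Sup_fin B \<le> g" "g \<in> S" using bound J by auto
    then show False using C s by (auto simp: H_iff)
  qed
  then have "Sup_fin J \<notin> G"
    using nested_R J S_incomparable unfolding nested_def by (blast intro: pairwise_subset)
  moreover have "Sup_fin (insert (Sup_fin B) J) = Sup_fin J"
    using J0 bound by (simp add: sup_absorb2)
  ultimately show False using t by simp
qed

text \<open>
  Consider an antichain \<open>B\<close> in the union. If it has an element above \<open>f\<close>, or contains \<open>f\<close>, all other
  elements are not below \<open>f\<close> and the definition of \<open>H\<close> or stability at \<open>f\<close> applies. If all elements lie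
  strictly below \<open>f\<close>, the two previous lemmas apply. In the remaining case some elements are
  incomparable to \<open>f\<close>. By stability their join with \<open>f\<close>, which is also the join of \<open>B\<close> with \<open>f\<close>, is
  outside \<open>G\<close>; an element of \<open>B\<close> below \<open>f\<close> would be a common lower bound of \<open>f\<close> and the join of \<open>B\<close>,
  so nestability excludes that the latter lies in \<open>G\<close>, and without such an element the join of \<open>B\<close>
  would lie in \<open>H\<close>, where \<open>N''\<close> is nested.
\<close>

lemma nested_Un:
  assumes N': "nested A N'" "f \<in> N'" and N'': "nested H N''"
  shows "nested G (N' \<union> N'')"
  unfolding nested_def
proof (intro conjI allI impI)
  have sub: "N' \<subseteq> A" "N'' \<subseteq> H" using N' N'' by (auto simp: nested_def)
  show NG: "N' \<union> N'' \<subseteq> G" using sub A_subset H_subset by blast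
  fix B assume B: "B \<subseteq> N' \<union> N''" and card: "2 \<le> card B" and inc: "pairwise incomparable B"
  have BG: "B \<subseteq> G" using B NG by (rule subset_trans)
  have ne: "B \<noteq> {}" using card by auto
  have s_ge: "b \<le> Sup_fin B" if "b \<in> B" for b using that by (simp add: Sup_fin.coboundedI)
  have in_A: "Sup_fin B \<notin> A" if "B \<subseteq> A"
  proof -
    have "b \<in> N'" if b: "b \<in> B" for b
    proof (cases "b \<in> N''")
      case True
      then have "b \<in> A \<inter> H" using b \<open>B \<subseteq> A\<close> sub by blast
      then show ?thesis using N'(2) by (simp add: A_Int_H)
    qed (use b B in blast)
    then have "B \<subseteq> N'" ..
    then show "Sup_fin B \<notin> A" using N' card inc by (auto simp: nested_def)
  qed
  have in_H: "Sup_fin B \<notin> H" if "B \<subseteq> N''" using that N'' card inc by (auto simp: nested_def)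
  have inc': "\<not> b \<le> c" if "b \<in> B" "c \<in> B" "b \<noteq> c" for b c
    using that inc unfolding pairwise_def incomparable_def by blast
  have N''_if: "b \<in> N''" if "b \<in> B" "\<not> b \<le> f" for b
    using that B sub A_iff by blast
  have sup_f: "sup b f \<notin> G" if "b \<in> B" "\<not> b \<le> f" "\<not> f \<le> b" for b
  proof -
    have "b \<in> H" using N''_if that sub by blast
    moreover have "\<not> b \<le> g" if "g \<in> S" for g using \<open>\<not> b \<le> f\<close> S_less_f[OF that] by auto
    ultimately show ?thesis using that by (auto simp: H_iff)
  qed
  define E where "E = {b\<in>B. \<not> b \<le> f}"
  show "Sup_fin B \<notin> G"
  proof (cases "f \<in> B")
    case True
    have E_eq: "E = B - {f}" using True inc' by (auto simp: E_def)
    have "E \<noteq> {}"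
    proof
      assume "E = {}"
      then have "B = {f}" using True E_eq by auto
      then show False using card by simp
    qed
    moreover have "sup f b \<notin> G" if "b \<in> E" for b
    proof -
      have "b \<in> B" "\<not> b \<le> f" "\<not> f \<le> b" using that E_eq True inc'[of f b] by (auto simp: E_def)
      then show ?thesis using sup_f by (simp add: sup_commute)
    qed
    ultimately have "Sup_fin (insert f E) \<notin> G"
      using BG by (intro stability[OF f_in_G]) (auto simp: E_def)
    then show ?thesis using True by (simp add: E_eq insert_absorb)
  next
    case f: False
    have low: "b \<in> A \<or> (\<exists>g\<in>S. b \<le> g)" if "b \<in> B" "b \<le> f" for b
    proof -
      have "\<not> f \<le> b" "sup b f \<in> G" using that f f_in_G by (auto simp: sup_absorb2 antisym)
      then show ?thesis using that B sub H_iff by blast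
    qed
    consider "E = {}" "B \<inter> A = {}" | "E = {}" "B \<inter> A \<noteq> {}" | b where "b \<in> E" "f \<le> b" 
      | "E \<noteq> {}" "\<forall>b\<in>E. \<not> f \<le> b" by blast
    then show ?thesis
    proof cases
      case 1
      then have *: "B \<subseteq> {h\<in>G. \<exists>g\<in>S. h \<le> g}" using low BG by (auto simp: E_def)
      have "B \<subseteq> N''" using 1 B sub by blast
      then show ?thesis using join_outside_if_below_S[OF * ne in_H] by blast
    next
      case 2
      then have "B \<subseteq> A \<union> {h\<in>G. \<exists>g\<in>S. h \<le> g}" "B \<inter> A - {f} \<noteq> {}"
        using low BG f by (auto simp: E_def)
      then show ?thesis using f inc in_A by (intro join_outside_if_below_f)
    next
      case 3
      have "\<not> c \<le> f" if "c \<in> B" for c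
      proof
        assume "c \<le> f"
        then have "c \<le> b" "c \<noteq> b" using 3 by (auto simp: E_def)
        then show False using inc'[OF that, of b] 3 by (auto simp: E_def)
      qed
      then have "B \<subseteq> N''" using N''_if by blast
      then have "Sup_fin B \<notin> H" by (rule in_H)
      moreover have "f \<le> Sup_fin B"
        using 3(2) s_ge[of b] 3(1) unfolding E_def by (blast intro: order.trans)
      ultimately show ?thesis by (auto simp: H_iff)
    next
      case 4
      have E: "E \<subseteq> G" "E \<subseteq> B" using BG by (auto simp: E_def)
      have u: "sup (Sup_fin E) f \<notin> G"
        using 4 E sup_f by (intro sup_join_notin_if_sups_notin) (auto simp: E_def)
      show ?thesis
      proof (cases "E = B")
        case True
        then have "B \<subseteq> N''" using N''_if by (auto simp: E_def)
        then have "Sup_fin B \<notin> H" by (rule in_H)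
        then show ?thesis using u True by (auto simp: H_iff)
      next
        case False
        then obtain c where c: "c \<in> B" "c \<le> f" by (auto simp: E_def)
        have "sup (Sup_fin B) f = sup (Sup_fin E) f"
        proof (rule antisym)
          have "b \<le> sup (Sup_fin E) f" if "b \<in> B" for b
          proof (cases "b \<le> f")
            case False
            then have "b \<le> Sup_fin E" using that by (intro Sup_fin.coboundedI) (auto simp: E_def)
            then show ?thesis by (rule le_supI1)
          qed (rule le_supI2)
          then show "sup (Sup_fin B) f \<le> sup (Sup_fin E) f"
            using ne by (auto intro!: Sup_fin.boundedI)
          have "Sup_fin E \<le> Sup_fin B" using 4 E by (intro Sup_fin.subset_imp) auto
          then show "sup (Sup_fin E) f \<le> sup (Sup_fin B) f" by (rule sup_mono) simp
        qed
        then show ?thesis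
          using u nestable_sup_in_if_common_lower_bound[OF nestable _ f_in_G s_ge[OF c(1)] c(2)] c BG by auto
      qed
    qed
  qed
qed

end

section \<open>Nested cones and causal forms in coordinates\<close>

lemma coord_simps [simp]:
  "pcoord (x + y) h = pcoord x h + pcoord y h" "mcoord (x + y) h = mcoord x h + mcoord y h"
  "pcoord (x - y) h = pcoord x h - pcoord y h" "mcoord (x - y) h = mcoord x h - mcoord y h"
  "pcoord (c *\<^sub>R x) h = c * pcoord x h" "mcoord (c *\<^sub>R x) h = c * mcoord x h"
  "pcoord 0 h = 0" "mcoord 0 h = 0"
  "pcoord (plus_vec g) h = (if h = g then 1 else 0)" "mcoord (plus_vec g) h = 0"
  "pcoord (minus_vec g) h = 0" "mcoord (minus_vec g) h = (if h = g then 1 else 0)"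
  by (simp_all add: pcoord_def mcoord_def plus_vec_def minus_vec_def axis_def)

lemma coord_sum [simp]:
  "pcoord (\<Sum>i\<in>I. v i) h = (\<Sum>i\<in>I. pcoord (v i) h)" "mcoord (\<Sum>i\<in>I. v i) h = (\<Sum>i\<in>I. mcoord (v i) h)"
  by (induction I rule: infinite_finite_induct) simp_all

lemma dvec_eq_iff: "x = y \<longleftrightarrow> (\<forall>h. pcoord x h = pcoord y h \<and> mcoord x h = mcoord y h)"
  by (auto simp: pcoord_def mcoord_def prod_eq_iff vec_eq_iff)

lemma dvec_expansion:
  fixes x :: "'a::finite dvec"
  assumes "\<And>h. h \<notin> M \<Longrightarrow> pcoord x h = 0 \<and> mcoord x h = 0"
  shows "x = (\<Sum>h\<in>M. pcoord x h *\<^sub>R plus_vec h + mcoord x h *\<^sub>R minus_vec h)"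
  using assms by (auto simp: dvec_eq_iff if_distrib[of "\<lambda>t. _ * t"] sum.delta cong: if_cong)

lemma dspace_iff: "x \<in> dspace M \<longleftrightarrow> (\<forall>h. h \<notin> M \<longrightarrow> pcoord x h = 0 \<and> mcoord x h = 0)"
proof
  have "subspace {x. \<forall>h. h \<notin> M \<longrightarrow> pcoord x h = 0 \<and> mcoord x h = 0}"
    by (simp add: subspace_def)
  then have "dspace M \<subseteq> {x. \<forall>h. h \<notin> M \<longrightarrow> pcoord x h = 0 \<and> mcoord x h = 0}"
    unfolding dspace_def by (rule span_minimal[rotated]) auto
  then show "x \<in> dspace M \<Longrightarrow> \<forall>h. h \<notin> M \<longrightarrow> pcoord x h = 0 \<and> mcoord x h = 0" by blast
next
  assume "\<forall>h. h \<notin> M \<longrightarrow> pcoord x h = 0 \<and> mcoord x h = 0"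
  then have "x = (\<Sum>h\<in>M. pcoord x h *\<^sub>R plus_vec h + mcoord x h *\<^sub>R minus_vec h)"
    by (intro dvec_expansion) blast
  also have "\<dots> \<in> dspace M"
    unfolding dspace_def by (intro span_sum span_add span_scale span_base) auto
  finally show "x \<in> dspace M" .
qed

lemma nested_cone_iff:
  "x \<in> nested_cone N \<longleftrightarrow>
     (\<forall>h. 0 \<le> pcoord x h \<and> 0 \<le> mcoord x h \<and> (h \<notin> N \<longrightarrow> pcoord x h = 0 \<and> mcoord x h = 0))"
    (is "_ \<longleftrightarrow> ?P x")
proof
  have "convex_cone {x. ?P x}" by (simp add: convex_cone_iff set_eq_iff)
  then have "nested_cone N \<subseteq> {x. ?P x}"
    unfolding nested_cone_def by (intro hull_minimal) auto
  then show "x \<in> nested_cone N \<Longrightarrow> ?P x" by blast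
next
  assume x: "?P x"
  have cone: "convex_cone (nested_cone N)"
    unfolding nested_cone_def by (rule convex_cone_convex_cone_hull)
  have gen: "plus_vec h \<in> nested_cone N" "minus_vec h \<in> nested_cone N" if "h \<in> N" for h
    unfolding nested_cone_def using that by (auto intro: hull_inc)
  have "(\<Sum>h\<in>M. pcoord x h *\<^sub>R plus_vec h + mcoord x h *\<^sub>R minus_vec h) \<in> nested_cone N"
    if "finite M" "M \<subseteq> N" for M
    using that
  proof (induction M)
    case empty
    then show ?case using convex_cone_contains_0[OF cone] by simp
  next
    case (insert h M)
    then have "pcoord x h *\<^sub>R plus_vec h + mcoord x h *\<^sub>R minus_vec h \<in> nested_cone N"
      using x gen by (intro convex_cone_add[OF cone] convex_cone_scaleR[OF cone]) auto
    then show ?case using insert by (simp add: convex_cone_add[OF cone])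
  qed
  from this[of N] dvec_expansion[of N x] x show "x \<in> nested_cone N" by simp
qed

lemma convex_cone_nested_cone: "convex_cone (nested_cone N)"
  unfolding nested_cone_def by (rule convex_cone_convex_cone_hull)

lemma causal_form_add: "causal_form G g (x + y) = causal_form G g x + causal_form G g y"
  by (simp add: causal_form_def algebra_simps sum.distrib sum_subtractf)

lemma causal_form_scaleR: "causal_form G g (c *\<^sub>R x) = c * causal_form G g x"
  by (simp add: causal_form_def algebra_simps sum_distrib_left)

lemma convex_cone_causal_cone: "convex_cone (causal_cone G)"
proof -
  have "0 \<in> causal_cone G"
    by (simp add: causal_cone_def dspace_iff causal_form_def)
  then show ?thesis
    unfolding convex_cone_iff
    by (auto simp: causal_cone_def dspace_iff causal_form_add causal_form_scaleR)
qed

lemma convex_cone_causal_slice: "convex_cone (nested_cone N \<inter> causal_cone G)"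
  using convex_cone_nested_cone[of N] convex_cone_causal_cone[of G]
  by (auto simp: convex_cone_iff)

lemma causal_slice_iff:
  assumes "N \<subseteq> G"
  shows "x \<in> nested_cone N \<inter> causal_cone G \<longleftrightarrow>
    x \<in> nested_cone N \<and> mcoord x top = 0 \<and> (\<forall>g\<in>G. 0 \<le> causal_form G g x)"
  using assms by (auto simp: causal_cone_def nested_cone_iff dspace_iff)

text \<open>
  Cutting a face of a nested cone by the causal cone gives a face of the cut nested cone, so faces of
  the cut full nested cones suffice.
\<close>

lemma universe_fan_iff:
  "\<tau> \<in> universe_fan G \<longleftrightarrow> \<tau> \<noteq> {} \<and> (\<exists>N. nested G N \<and> \<tau> face_of (nested_cone N \<inter> causal_cone G))"
proof
  assume "\<tau> \<in> universe_fan G"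
  then obtain \<sigma> N where *: "\<tau> \<noteq> {}" "nested G N" "\<sigma> face_of nested_cone N"
      "\<tau> face_of (\<sigma> \<inter> causal_cone G)"
    by (auto simp: universe_fan_def nested_fan_def nested_complex_def)
  then have "\<tau> face_of (nested_cone N \<inter> causal_cone G)"
    using convex_cone_causal_cone[of G] face_of_trans[OF *(4) face_of_slice[OF *(3)]]
    by (simp add: convex_cone_def)
  then show "\<tau> \<noteq> {} \<and> (\<exists>N. nested G N \<and> \<tau> face_of (nested_cone N \<inter> causal_cone G))"
    using * by blast
next
  assume "\<tau> \<noteq> {} \<and> (\<exists>N. nested G N \<and> \<tau> face_of (nested_cone N \<inter> causal_cone G))"
  then obtain N where *: "\<tau> \<noteq> {}" "nested G N" "\<tau> face_of (nested_cone N \<inter> causal_cone G)"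
    by blast
  have "nested_cone N \<in> nested_fan G"
    using *(2) convex_cone_nested_cone[of N]
    by (auto simp: nested_fan_def nested_complex_def convex_cone_def intro: face_of_refl)
  then show "\<tau> \<in> universe_fan G" using * by (auto simp: universe_fan_def)
qed

lemma causal_form_eq_sum_nested:
  assumes "x \<in> nested_cone N" "N \<subseteq> G"
  shows "causal_form G g x =
    pcoord x top + (\<Sum>h\<in>{h\<in>N. g < h \<and> h < top}. pcoord x h - mcoord x h) - mcoord x g"
proof -
  have "(\<Sum>h\<in>{h\<in>G. g < h \<and> h < top}. pcoord x h - mcoord x h) =
      (\<Sum>h\<in>{h\<in>N. g < h \<and> h < top}. pcoord x h - mcoord x h)"
    using assms by (intro sum.mono_neutral_right) (auto simp: nested_cone_iff)
  then show ?thesis by (simp add: causal_form_def)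
qed

text \<open>
  Inside a nested cone the inequalities \<open>F_g \<ge> 0\<close> with \<open>g \<notin> N\<close> are redundant. By nestability the
  elements of \<open>N\<close> above \<open>g\<close> form a chain. If \<open>h\<close> is the least of them and \<open>h < top\<close>, then
  \<open>F_g = F_h + p_h\<close>; if there is none below \<open>top\<close>, then \<open>F_g = p_top\<close>.
\<close>

lemma causal_form_nonneg_if_nonneg_on_nested:
  assumes nestable: "nestable G" and N: "nested G N" and x: "x \<in> nested_cone N"
    and nonneg: "\<And>g. g \<in> N \<Longrightarrow> 0 \<le> causal_form G g x" and g: "g \<in> G"
  shows "0 \<le> causal_form G g x"
proof (cases "g \<in> N")
  case False
  have NG: "N \<subseteq> G" using N by (simp add: nested_def)
  note F = causal_form_eq_sum_nested[OF x NG]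
  have coord: "mcoord x g = 0" "\<And>h. 0 \<le> pcoord x h" using x False by (auto simp: nested_cone_iff)
  let ?B = "{h\<in>N. g < h \<and> h < top}"
  show ?thesis
  proof (cases "?B = {}")
    case True
    show ?thesis unfolding F True using coord by simp
  next
    case False
    from finite_has_minimal[OF _ False] obtain h where
      h: "h \<in> ?B" and min: "\<And>k. k \<in> ?B \<Longrightarrow> k \<le> h \<Longrightarrow> k = h" by auto
    have "h \<le> k" if k: "k \<in> ?B" for k
    proof (rule ccontr)
      assume "\<not> h \<le> k"
      moreover from this have "\<not> k \<le> h" using min[OF k] by auto
      ultimately have "sup h k \<notin> G"
        using h k by (intro nested_pair[OF N]) (auto simp: incomparable_def)
      then show False
        using nestable_sup_in_if_common_lower_bound[OF nestable _ _ less_imp_le less_imp_le g, of h k] h k NG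
        by blast
    qed
    then have "?B = insert h {k\<in>N. h < k \<and> k < top}"
      using h by (auto simp: less_le)
    then have "causal_form G g x = causal_form G h x + pcoord x h"
      unfolding F using coord by simp
    then show ?thesis using nonneg[of h] h coord(2)[of h] by simp
  qed
qed (rule nonneg)

section \<open>Decomposition of the link at a causal region\<close>

lemma span_Times_axes:
  fixes T1 :: "'v::real_vector set" and T2 :: "'w::real_vector set"
  shows "span (T1 \<times> {0} \<union> {0} \<times> T2) = span T1 \<times> span T2"
proof -
  have lin: "linear (\<lambda>x :: 'v. (x, 0 :: 'w))" "linear (\<lambda>y :: 'w. (0 :: 'v, y))"
    by (auto intro!: linearI)
  have "T1 \<times> {0} = (\<lambda>x. (x, 0 :: 'w)) ` T1" "{0} \<times> T2 = (\<lambda>y. (0 :: 'v, y)) ` T2" by auto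
  then have *: "span (T1 \<times> {0}) = (\<lambda>x. (x, 0 :: 'w)) ` span T1"
    "span ({0} \<times> T2) = (\<lambda>y. (0 :: 'v, y)) ` span T2"
    using linear_span_image[OF lin(1), of T1] linear_span_image[OF lin(2), of T2] by simp_all
  show ?thesis
  proof (intro set_eqI iffI)
    fix z assume "z \<in> span (T1 \<times> {0} \<union> {0} \<times> T2)"
    then show "z \<in> span T1 \<times> span T2" unfolding span_Un * by auto
  next
    fix z assume z: "z \<in> span T1 \<times> span T2"
    have "(fst z, 0) + (0, snd z) \<in> span (T1 \<times> {0} \<union> {0} \<times> T2)"
    proof (rule span_add)
      have "(fst z, 0 :: 'w) \<in> span (T1 \<times> {0})" "(0 :: 'v, snd z) \<in> span ({0} \<times> T2)"
        unfolding * using z by auto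
      then show "(fst z, 0) \<in> span (T1 \<times> {0} \<union> {0} \<times> T2)" "(0, snd z) \<in> span (T1 \<times> {0} \<union> {0} \<times> T2)"
        using span_mono[of "T1 \<times> {0}" "T1 \<times> {0} \<union> {0} \<times> T2"]
          span_mono[of "{0} \<times> T2" "T1 \<times> {0} \<union> {0} \<times> T2"] by blast+
    qed
    then show "z \<in> span (T1 \<times> {0} \<union> {0} \<times> T2)" by simp
  qed
qed

context stable_causal_region
begin

text \<open>
  \<open>shift x h\<close> is the contribution of the coordinates in \<open>A\<close> between \<open>h\<close> and \<open>f\<close> to \<open>F_g\<close> for \<open>g \<le> h\<close>.
  The map \<open>\<Phi>\<close> separates the coordinates of \<open>A - {f}\<close> from those of \<open>H\<close> and moves this contribution
  into the coordinate \<open>m_h\<close>, for \<open>h \<in> S\<close>. The coordinates of \<open>f\<close> go to the second factor only; in the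
  first one they are divided out.
\<close>

definition shift where "shift x h = (\<Sum>k\<in>{k\<in>A. h < k \<and> k < f}. pcoord x k - mcoord x k)"

definition \<Phi> :: "'a dvec \<Rightarrow> 'a dvec \<times> 'a dvec" where
  "\<Phi> x = (((\<chi> h. if h \<in> A - {f} then pcoord x h else 0), (\<chi> h. if h \<in> A - {f} then mcoord x h else 0)),
     ((\<chi> h. if h \<in> H then pcoord x h else 0),
      (\<chi> h. if h \<in> H then mcoord x h - (if h \<in> S then shift x h else 0) else 0)))"

lemma \<Phi>_coord [simp]:
  "pcoord (fst (\<Phi> x)) h = (if h \<in> A - {f} then pcoord x h else 0)"
  "mcoord (fst (\<Phi> x)) h = (if h \<in> A - {f} then mcoord x h else 0)"
  "pcoord (snd (\<Phi> x)) h = (if h \<in> H then pcoord x h else 0)"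
  "mcoord (snd (\<Phi> x)) h = (if h \<in> H then mcoord x h - (if h \<in> S then shift x h else 0) else 0)"
  by (simp_all add: \<Phi>_def pcoord_def mcoord_def)

lemma shift_add: "shift (x + y) h = shift x h + shift y h"
  by (simp add: shift_def sum.distrib sum_subtractf)

lemma shift_scaleR: "shift (c *\<^sub>R x) h = c * shift x h"
  by (simp add: shift_def sum_distrib_left algebra_simps)

lemma linear_\<Phi>: "linear \<Phi>"
  by (rule linearI)
    (auto simp: prod_eq_iff[of "\<Phi> _"] dvec_eq_iff shift_add shift_scaleR right_diff_distrib)

abbreviation w where "w \<equiv> region_vec R f"

lemma w_coord [simp]:
  "pcoord w h = (if h = f then 1 else 0)" "mcoord w h = (if h \<in> S then 1 else 0)"
  by (auto simp: region_vec_def S_def if_distrib sum.delta cong: if_cong)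

lemma f_notin_S: "f \<notin> S" by (simp add: S_def)

lemma S_less_top: "h \<in> S \<Longrightarrow> h < top"
  using S_less_f by (rule less_le_trans) simp_all

lemma S_subset_H: "S \<subseteq> H" using R_subset_H by (auto simp: S_def)

lemma A_minus_f_notin_H: "h \<in> A \<Longrightarrow> h \<noteq> f \<Longrightarrow> h \<notin> H" using A_Int_H by blast

lemma A_notin_S: "h \<in> A \<Longrightarrow> h \<notin> S"
  using A_minus_f_notin_H S_subset_H f_notin_S by blast

lemma A_above_below_S:
  assumes "g \<in> G" "h \<in> S" "g \<le> h" "k \<in> A" "g < k"
  shows "h < k"
proof -
  have "sup k h \<in> G"
    using nestable_sup_in_if_common_lower_bound[OF nestable, of k h g] assms A_subset S_subset
    by (auto simp: subset_iff)
  then show ?thesis using assms by (auto simp: A_iff)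
qed

text \<open>
  At most one \<open>h \<in> S\<close> lies above \<open>g\<close>, and then the elements of \<open>A\<close> above \<open>g\<close> lie above \<open>h\<close>. If there
  is none, then \<open>g\<close> is not strictly below \<open>f\<close> and both sides vanish.
\<close>

lemma sum_shift:
  assumes g: "g \<in> H"
  shows "(\<Sum>h\<in>{h\<in>S. g \<le> h}. shift x h) = shift x g"
proof (cases "\<exists>h\<in>S. g \<le> h")
  case True
  then obtain h where h: "h \<in> S" "g \<le> h" by blast
  have "g \<in> G" using g H_subset by blast
  then have "{h\<in>S. g \<le> h} = {h}" using h below_S_unique by blast
  moreover have "{k\<in>A. h < k \<and> k < f} = {k\<in>A. g < k \<and> k < f}"
    using A_above_below_S[OF \<open>g \<in> G\<close> h] h(2) by auto
  ultimately show ?thesis by (simp add: shift_def)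
next
  case False
  then have "f \<le> g \<or> sup g f \<notin> G" using g by (auto simp: H_iff intro: less_imp_le)
  then have "\<not> g < f" using f_in_G by (auto simp: sup_absorb2)
  then have "{k\<in>A. g < k \<and> k < f} = {}" by auto
  moreover have "{h\<in>S. g \<le> h} = {}" using False by auto
  ultimately show ?thesis by (simp only: shift_def sum.empty)
qed

text \<open>
  The causal forms of \<open>G\<close> and \<open>H\<close> differ by the coordinates in \<open>A - {f}\<close>, and \<open>\<Phi>\<close> is designed to
  compensate for this.
\<close>

lemma causal_form_\<Phi>:
  assumes g: "g \<in> H" and x: "x \<in> dspace (A \<union> H)"
  shows "causal_form H g (snd (\<Phi> x)) = causal_form G g x"
proof -
  let ?d = "\<lambda>h. pcoord x h - mcoord x h"
  let ?I = "\<lambda>M. {h\<in>M. g < h \<and> h < top}"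
  have "sum ?d (?I G) = sum ?d (?I (A \<union> H))"
    using x A_subset H_subset by (intro sum.mono_neutral_right) (auto simp: dspace_iff)
  also have "?I (A \<union> H) = {k\<in>A. g < k \<and> k < f} \<union> ?I H"
  proof (intro set_eqI)
    fix h
    have "h < top" if "h < f" using that by (rule less_le_trans) simp
    moreover have "h \<in> A \<Longrightarrow> h < f \<or> h = f" by (auto simp: A_iff less_le)
    ultimately show "h \<in> ?I (A \<union> H) \<longleftrightarrow> h \<in> {k\<in>A. g < k \<and> k < f} \<union> ?I H"
      using R_subset_H f_in_R by blast
  qed
  also have "sum ?d \<dots> = shift x g + sum ?d (?I H)"
    unfolding shift_def using A_minus_f_notin_H by (intro sum.union_disjoint) auto
  finally have G: "sum ?d (?I G) = shift x g + sum ?d (?I H)" .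
  have H: "(\<Sum>h\<in>?I H. pcoord (snd (\<Phi> x)) h - mcoord (snd (\<Phi> x)) h) =
      sum ?d (?I H) + (\<Sum>h\<in>{h\<in>S. g < h}. shift x h)"
  proof -
    have "(\<Sum>h\<in>?I H. pcoord (snd (\<Phi> x)) h - mcoord (snd (\<Phi> x)) h) =
        sum ?d (?I H) + (\<Sum>h\<in>?I H. if h \<in> S then shift x h else 0)"
      unfolding sum.distrib[symmetric] by (intro sum.cong) auto
    also have "(\<Sum>h\<in>?I H. if h \<in> S then shift x h else 0) = (\<Sum>h\<in>?I H \<inter> S. shift x h)"
      by (simp add: sum.inter_restrict)
    also have "?I H \<inter> S = {h\<in>S. g < h}"
      using S_subset_H S_less_top by auto
    finally show ?thesis .
  qed
  have split: "(\<Sum>h\<in>{h\<in>S. g \<le> h}. shift x h) =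
      (\<Sum>h\<in>{h\<in>S. g < h}. shift x h) + (if g \<in> S then shift x g else 0)"
  proof (cases "g \<in> S")
    case True
    then have "{h\<in>S. g \<le> h} = insert g {h\<in>S. g < h}" by (auto simp: less_le)
    then show ?thesis using True by simp
  next
    case False
    then have "{h\<in>S. g \<le> h} = {h\<in>S. g < h}" by (auto simp: less_le)
    then show ?thesis using False by simp
  qed
  show ?thesis
    unfolding causal_form_def H G
    using split g top_in_H by (simp add: sum_shift[OF g])
qed

text \<open>
  The forms that are positive at \<open>w\<close> impose no condition on the link. By this formula they include
  all forms of elements of \<open>A - {f}\<close>.
\<close>

lemma causal_form_w:
  assumes g: "g \<in> G"
  shows "causal_form G g w = (if (g < f \<or> f = top) \<and> (\<forall>h\<in>S. \<not> g \<le> h) then 1 else 0)"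
proof -
  let ?I = "{h\<in>G. g < h \<and> h < top}"
  have "(\<Sum>h\<in>?I. pcoord w h - mcoord w h) = (\<Sum>h\<in>?I. if h = f then 1 else 0) - (\<Sum>h\<in>?I. if h \<in> S then 1 else 0)"
    by (simp add: sum_subtractf)
  also have "(\<Sum>h\<in>?I. if h = f then 1 else 0 :: real) = (if g < f \<and> f < top then 1 else 0)"
    using f_in_G by (simp add: sum.delta)
  also have "(\<Sum>h\<in>?I. if h \<in> S then 1 else 0 :: real) = card {h\<in>S. g < h}"
  proof -
    have "?I \<inter> S = {h\<in>S. g < h}" using S_subset S_less_top by auto
    then show ?thesis by (simp add: sum.If_cases Int_def[symmetric])
  qed
  finally have F: "causal_form G g w = (if f = top then 1 else 0) + (if g < f \<and> f < top then 1 else 0)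
      - real (card {h\<in>S. g < h}) - (if g \<in> S then 1 else 0)"
    by (simp add: causal_form_def)
  show ?thesis
  proof (cases "\<exists>h\<in>S. g \<le> h")
    case True
    then obtain h where h: "h \<in> S" "g \<le> h" by blast
    then have uniq: "h' = h" if "h' \<in> S" "g \<le> h'" for h' using below_S_unique g that by blast
    have "g < f" using h S_less_f[OF h(1)] by simp
    show ?thesis
    proof (cases "g = h")
      case True
      then have "{h\<in>S. g < h} = {}" using uniq less_le by blast
      then show ?thesis using True h \<open>g < f\<close> unfolding F by (auto simp: less_top)
    next
      case False
      then have "g < h" using h(2) by simp
      then have "{h\<in>S. g < h} = {h}" "g \<notin> S" using uniq h(1) False less_imp_le by blast+
      then show ?thesis using h \<open>g < f\<close> unfolding F by (auto simp: less_top)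
    qed
  next
    case False
    then have "{h\<in>S. g < h} = {}" "g \<notin> S" by (auto simp: less_le)
    then show ?thesis using False unfolding F by (auto simp: less_top)
  qed
qed

lemma w_in_nested_cone_iff: "w \<in> nested_cone N \<longleftrightarrow> R \<subseteq> N"
  by (auto simp: nested_cone_iff R_iff subset_iff)

lemma w_in_causal_slice:
  assumes "R \<subseteq> N" "N \<subseteq> G"
  shows "w \<in> nested_cone N \<inter> causal_cone G"
  unfolding causal_slice_iff[OF assms(2)]
  using assms S_less_top by (auto simp: causal_form_w w_in_nested_cone_iff)

lemma w_in_dspace: "w \<in> dspace (A \<union> H)"
  using R_subset_H by (auto simp: dspace_iff R_iff subset_iff)

lemma snd_\<Phi>_w: "snd (\<Phi> w) = w" and fst_\<Phi>_w: "fst (\<Phi> w) = 0"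
proof -
  have "shift w h = 0" for h
    using A_notin_S by (auto simp: shift_def intro!: sum.neutral)
  moreover have "R \<subseteq> H" by (rule R_subset_H)
  ultimately show "snd (\<Phi> w) = w" by (auto simp: dvec_eq_iff R_iff subset_iff)
  show "fst (\<Phi> w) = 0" using A_notin_S by (auto simp: dvec_eq_iff)
qed

lemma w_in_causal_slice_H:
  assumes "R \<subseteq> N" "N \<subseteq> H"
  shows "w \<in> nested_cone N \<inter> causal_cone H"
proof -
  have "causal_form H g w = causal_form G g w" if "g \<in> H" for g
    using causal_form_\<Phi>[OF that w_in_dspace] by (simp add: snd_\<Phi>_w)
  then show ?thesis
    unfolding causal_slice_iff[OF assms(2)]
    using assms S_less_top H_subset
    by (auto simp: causal_form_w w_in_nested_cone_iff subset_iff)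
qed

abbreviation W' where "W' \<equiv> span {plus_vec f, minus_vec f} \<times> span {w}"

lemma in_span_axes_iff:
  "x \<in> span {plus_vec f, minus_vec f} \<longleftrightarrow> (\<forall>h. h \<noteq> f \<longrightarrow> pcoord x h = 0 \<and> mcoord x h = 0)"
  using dspace_iff[of x "{f}"] by (simp add: dspace_def insert_commute)

lemma \<Phi>_injective_mod_w:
  assumes x: "x \<in> dspace (A \<union> H)" and \<Phi>: "\<Phi> x \<in> W'"
  shows "x \<in> span {w}"
proof -
  obtain c where c: "snd (\<Phi> x) = c *\<^sub>R w" using \<Phi> by (auto simp: span_singleton mem_Times_iff)
  have fst0: "pcoord x h = 0 \<and> mcoord x h = 0" if "h \<in> A" "h \<noteq> f" for h
  proof -
    have "fst (\<Phi> x) \<in> span {plus_vec f, minus_vec f}" using \<Phi> by (simp add: mem_Times_iff)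
    then have "pcoord (fst (\<Phi> x)) h = 0 \<and> mcoord (fst (\<Phi> x)) h = 0"
      using that by (simp only: in_span_axes_iff) blast
    then show ?thesis using that by simp
  qed
  have shift: "shift x h = 0" for h
    unfolding shift_def using fst0 by (intro sum.neutral) auto
  have "x = c *\<^sub>R w"
    unfolding dvec_eq_iff
  proof
    fix h
    consider "h \<in> H" | "h \<in> A" "h \<notin> H" | "h \<notin> A \<union> H" by blast
    then show "pcoord x h = pcoord (c *\<^sub>R w) h \<and> mcoord x h = mcoord (c *\<^sub>R w) h"
    proof cases
      case 1
      then show ?thesis
        using arg_cong[OF c, of "\<lambda>y. pcoord y h"] arg_cong[OF c, of "\<lambda>y. mcoord y h"]
        by (simp add: shift split: if_splits)
    next
      case 2
      then have "h \<noteq> f" "h \<notin> S" using R_subset_H f_in_R S_subset_H by auto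
      then show ?thesis using fst0 2 by simp
    next
      case 3
      then have "h \<noteq> f" "h \<notin> S" using R_subset_H f_in_R S_subset_H by auto
      then show ?thesis using x 3 by (simp add: dspace_iff)
    qed
  qed
  then show ?thesis by (simp add: span_base span_scale)
qed

lemma \<Phi>_span_w: "x \<in> span {w} \<Longrightarrow> \<Phi> x \<in> W'"
  by (auto simp: span_singleton mem_Times_iff linear_scale[OF linear_\<Phi>] fst_\<Phi>_w snd_\<Phi>_w span_0)

text \<open>
  Modulo \<open>w\<close>, a vector may be moved by large multiples of \<open>w\<close>. This repairs the only conditions that
  \<open>\<Phi>\<close> and its inverse can violate: nonnegativity of the coordinates \<open>m_h\<close> for \<open>h \<in> S\<close>, which \<open>\<Phi>\<close>
  shifts, and for the inverse also \<open>F_g \<ge> 0\<close> for \<open>g \<in> A - {f}\<close>, where \<open>F_g\<close> is \<open>1\<close> at \<open>w\<close>. The other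
  causal forms are the same on both sides and are nonnegative at \<open>w\<close>.
\<close>

lemma \<Phi>_image_causal_slice:
  assumes N: "nested G N" "R \<subseteq> N"
  shows "\<Phi> ` (nested_cone N \<inter> causal_cone G) + W' =
    nested_cone (N \<inter> A) \<times> (nested_cone (N \<inter> H) \<inter> causal_cone H) + W'" (is "\<Phi> ` ?K + _ = ?K' + _")
proof
  have NG: "N \<subseteq> G" and NAH: "N \<subseteq> A \<union> H"
    using N nested_subset_A_Un_H by (auto simp: nested_def)
  have NH: "N \<inter> H \<subseteq> H" by blast
  have absorb: "Z + W' \<subseteq> Z' + W'" if sub: "\<And>z. z \<in> Z \<Longrightarrow> \<exists>z'\<in>Z'. z - z' \<in> W'" for Z Z'
  proof
    fix y assume "y \<in> Z + W'"
    then obtain z v where z: "y = z + v" "z \<in> Z" "v \<in> W'" by (rule set_plus_elim)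
    from sub[OF z(2)] obtain z' where z': "z' \<in> Z'" "z - z' \<in> W'" by (rule bexE)
    have "subspace W'" by (intro subspace_Times subspace_span)
    from set_plus_intro[OF z'(1) subspace_add[OF this z'(2) z(3)]]
    have "z' + ((z - z') + v) \<in> Z' + W'" .
    then show "y \<in> Z' + W'" using z by simp
  qed
  have coord_top: "mcoord z top = 0" if "z \<in> causal_cone M" for z M
    using that by (simp add: causal_cone_def)
  show "\<Phi> ` ?K + W' \<subseteq> ?K' + W'"
  proof (rule absorb)
    fix z assume "z \<in> \<Phi> ` ?K"
    then obtain x where x: "x \<in> ?K" and z: "z = \<Phi> x" by blast
    have nonneg: "0 \<le> pcoord x h" "0 \<le> mcoord x h" for h using x by (auto simp: nested_cone_iff)
    have supp: "pcoord x h = 0" "mcoord x h = 0" if "h \<notin> N" for h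
      using x that by (auto simp: nested_cone_iff)
    have xD: "x \<in> dspace (A \<union> H)" using supp NAH by (auto simp: dspace_iff)
    \<comment> \<open>An upper bound for all shifts of \<open>x\<close>.\<close>
    define t where "t = (\<Sum>k\<in>A. pcoord x k)"
    have t: "0 \<le> t" "shift x h \<le> t" for h
    proof -
      show "0 \<le> t" unfolding t_def using nonneg by (intro sum_nonneg)
      have "shift x h \<le> (\<Sum>k\<in>{k\<in>A. h < k \<and> k < f}. pcoord x k)"
        unfolding shift_def using nonneg by (intro sum_mono) simp
      also have "\<dots> \<le> t" unfolding t_def using nonneg by (intro sum_mono2) auto
      finally show "shift x h \<le> t" .
    qed
    define y where "y = snd (\<Phi> x) + t *\<^sub>R w"
    have "fst (\<Phi> x) \<in> nested_cone (N \<inter> A)"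
      using nonneg supp by (auto simp: nested_cone_iff)
    moreover have "y \<in> nested_cone (N \<inter> H)"
    proof -
      have "0 \<le> mcoord x h - shift x h + t" for h using nonneg[of h] t(2)[of h] by simp
      moreover have "h \<in> N" "h \<in> H" if "h = f \<or> h \<in> S" for h
        using that N(2) R_subset_H by (auto simp: R_iff subset_iff)
      ultimately show ?thesis
        using nonneg supp t(1) by (auto simp: nested_cone_iff y_def)
    qed
    moreover have "mcoord y top = 0"
      using x coord_top[of x G] S_less_top by (auto simp: y_def)
    moreover have "0 \<le> causal_form H g y" if g: "g \<in> H" for g
    proof -
      have "causal_form H g y = causal_form G g x + t * causal_form H g w"
        by (simp add: y_def causal_form_add causal_form_scaleR causal_form_\<Phi>[OF g xD])
      moreover have "0 \<le> causal_form G g x" using x g H_subset by (auto simp: causal_cone_def)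
      moreover have "0 \<le> causal_form H g w"
        using w_in_causal_slice_H[OF R_subset_H order_refl] g by (auto simp: causal_cone_def)
      ultimately show ?thesis using t(1) by simp
    qed
    ultimately have "(fst (\<Phi> x), y) \<in> ?K'"
      unfolding mem_Times_iff causal_slice_iff[OF NH] by simp
    moreover have "\<Phi> x - (fst (\<Phi> x), y) \<in> W'"
      by (simp add: y_def mem_Times_iff span_0 span_neg span_scale span_base)
    ultimately show "\<exists>z'\<in>?K'. z - z' \<in> W'" unfolding z by (rule bexI[rotated])
  qed
  show "?K' + W' \<subseteq> \<Phi> ` ?K + W'"
  proof (rule absorb)
    fix z assume "z \<in> ?K'"
    then obtain a b where z: "z = (a, b)" and a: "a \<in> nested_cone (N \<inter> A)"
      and b: "b \<in> nested_cone (N \<inter> H)" "b \<in> causal_cone H" by blast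
    have nonneg: "0 \<le> pcoord a h" "0 \<le> mcoord a h" "0 \<le> pcoord b h" "0 \<le> mcoord b h" for h
      using a b by (auto simp: nested_cone_iff)
    have supp_a: "pcoord a h = 0" "mcoord a h = 0" if "h \<notin> N \<inter> A" for h
      using a that by (auto simp: nested_cone_iff)
    have supp_b: "pcoord b h = 0" "mcoord b h = 0" if "h \<notin> N \<inter> H" for h
      using b that by (auto simp: nested_cone_iff)
    \<comment> \<open>The inverse of \<open>\<Phi>\<close> up to the coordinates of \<open>f\<close> in \<open>a\<close>, which are dropped.\<close>
    define u :: "'a dvec" where "u =
      ((\<chi> h. if h \<in> A - {f} then pcoord a h else pcoord b h),
       (\<chi> h. if h \<in> A - {f} then mcoord a h else mcoord b h + (if h \<in> S then shift a h else 0)))"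
    have u: "pcoord u h = (if h \<in> A - {f} then pcoord a h else pcoord b h)"
      "mcoord u h = (if h \<in> A - {f} then mcoord a h else mcoord b h + (if h \<in> S then shift a h else 0))"
      for h by (simp_all add: u_def pcoord_def mcoord_def)
    \<comment> \<open>Large enough to make all coordinates \<open>m_h\<close> and all causal forms of \<open>u\<close> nonnegative when added.\<close>
    define t where "t = (\<Sum>h\<in>UNIV. \<bar>mcoord u h\<bar>) + (\<Sum>g\<in>UNIV. \<bar>causal_form G g u\<bar>)"
    have t0: "\<bar>mcoord u h\<bar> \<le> t" "\<bar>causal_form G h u\<bar> \<le> t" for h
    proof -
      have "\<bar>mcoord u h\<bar> \<le> (\<Sum>h\<in>UNIV. \<bar>mcoord u h\<bar>)"
        by (rule member_le_sum) auto
      moreover have "\<bar>causal_form G h u\<bar> \<le> (\<Sum>g\<in>UNIV. \<bar>causal_form G g u\<bar>)"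
        by (rule member_le_sum[where f = "\<lambda>g. \<bar>causal_form G g u\<bar>"]) auto
      moreover have "0 \<le> (\<Sum>h\<in>UNIV. \<bar>mcoord u h\<bar>)" "0 \<le> (\<Sum>g\<in>UNIV. \<bar>causal_form G g u\<bar>)"
        by (simp_all add: sum_nonneg)
      ultimately show "\<bar>mcoord u h\<bar> \<le> t" "\<bar>causal_form G h u\<bar> \<le> t" by (simp_all add: t_def)
    qed
    have t: "0 \<le> t" "0 \<le> mcoord u h + t" "0 \<le> causal_form G h u + t" for h
      using t0[of h] by linarith+
    define x where "x = u + t *\<^sub>R w"
    have SN: "h \<in> N" "h \<in> H" if "h \<in> S" for h using that N(2) S_subset_H by (auto simp: R_iff)
    have shift: "shift u h = shift a h" "shift x h = shift a h" for h
    proof -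
      show *: "shift u h = shift a h" unfolding shift_def by (intro sum.cong) (auto simp: u)
      have "shift w h = 0" using A_notin_S by (auto simp: shift_def intro!: sum.neutral)
      then show "shift x h = shift a h" by (simp add: x_def shift_add shift_scaleR *)
    qed
    have x_cone: "x \<in> nested_cone N"
      unfolding nested_cone_iff
    proof (intro allI conjI impI)
      fix h
      show "0 \<le> pcoord x h" using nonneg t(1) by (simp add: x_def u)
      show "0 \<le> mcoord x h"
      proof (cases "h \<in> S")
        case True
        then show ?thesis using t(2)[of h] by (simp add: x_def)
      next
        case False
        then show ?thesis using nonneg by (simp add: x_def u)
      qed
      assume "h \<notin> N"
      moreover from this have "h \<noteq> f" "h \<notin> S" using N(2) f_in_R SN by auto
      ultimately show "pcoord x h = 0" "mcoord x h = 0" using supp_a supp_b by (simp_all add: x_def u)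
    qed
    have xD: "x \<in> dspace (A \<union> H)" using x_cone NAH by (auto simp: dspace_iff nested_cone_iff)
    have snd_\<Phi>_x: "snd (\<Phi> x) = b + t *\<^sub>R w"
    proof -
      have "pcoord x h = pcoord (b + t *\<^sub>R w) h"
        "mcoord x h = mcoord (b + t *\<^sub>R w) h + (if h \<in> S then shift a h else 0)" if "h \<in> H" for h
        using that A_Int_H by (auto simp: x_def u)
      moreover have "pcoord (b + t *\<^sub>R w) h = 0" "mcoord (b + t *\<^sub>R w) h = 0" if "h \<notin> H" for h
        using that supp_b[of h] SN R_subset_H f_in_R by auto
      ultimately show ?thesis unfolding dvec_eq_iff \<Phi>_coord shift by simp
    qed
    have nonneg_N: "0 \<le> causal_form G g x" if g: "g \<in> N" for g
    proof (cases "g \<in> H")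
      case True
      have "causal_form G g x = causal_form H g b + t * causal_form H g w"
        unfolding causal_form_\<Phi>[OF True xD, symmetric] snd_\<Phi>_x
        by (simp add: causal_form_add causal_form_scaleR)
      moreover have "0 \<le> causal_form H g b" using b(2) True by (simp add: causal_cone_def)
      moreover have "0 \<le> causal_form H g w"
        using w_in_causal_slice_H[OF R_subset_H order_refl] True by (auto simp: causal_cone_def)
      ultimately show ?thesis using t(1) by simp
    next
      case False
      then have "g \<in> A" "g \<noteq> f" using g NAH R_subset_H f_in_R by auto
      then have "g < f" "\<forall>h\<in>S. \<not> g \<le> h" using False by (auto simp: A_iff H_iff)
      then have "causal_form G g w = 1" using g NG by (auto simp: causal_form_w)
      then show ?thesis using t(3)[of g] by (simp add: x_def causal_form_add causal_form_scaleR)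
    qed
    have "mcoord x top = 0"
    proof -
      have "top \<notin> A - {f}" "top \<notin> S" using A_minus_f_notin_H top_in_H S_less_top by auto
      then show ?thesis using coord_top[OF b(2)] by (auto simp: x_def u)
    qed
    then have "x \<in> ?K"
      using x_cone causal_form_nonneg_if_nonneg_on_nested[OF nestable N(1) x_cone nonneg_N]
      unfolding causal_slice_iff[OF NG] by simp
    moreover have "z - \<Phi> x \<in> W'"
    proof -
      have "a - fst (\<Phi> x) \<in> span {plus_vec f, minus_vec f}"
        unfolding in_span_axes_iff using supp_a A_notin_S by (auto simp: x_def u)
      moreover have "b - snd (\<Phi> x) \<in> span {w}"
        by (simp add: snd_\<Phi>_x span_neg span_scale span_base)
      ultimately show ?thesis by (simp add: z mem_Times_iff)
    qed
    ultimately show "\<exists>z'\<in>\<Phi> ` ?K. z - z' \<in> W'" by (intro bexI[of _ "\<Phi> x"] imageI)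
  qed
qed

text \<open>
  A cone of the link is a face of a slice of a nested cone for some \<open>N\<close> with \<open>R \<subseteq> N\<close>, and a product
  of cones of the two factors is a face of a product of cones for nested sets of \<open>A\<close> and \<open>H\<close> that
  contain \<open>f\<close> and \<open>R\<close>. The former nested sets split into the latter, which unite to the former, and \<open>\<Phi>\<close>
  identifies the corresponding cones, hence their faces.
\<close>

lemma universe_fan_link_decomposition:
  "fan_isomorphic
     (link (universe_fan G) {w})
     (fan_prod (link (nested_fan A) {plus_vec f, minus_vec f}) (link (universe_fan H) {w}))"
proof -
  let ?T1 = "{plus_vec f, minus_vec f} :: 'a dvec set"
  let ?K = "\<lambda>G N. nested_cone N \<inter> causal_cone G"
  let ?S0 = "{\<sigma>\<in>universe_fan G. convex_cone hull {w} \<subseteq> \<sigma>}"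
  let ?S1 = "{\<sigma>\<in>nested_fan A. convex_cone hull ?T1 \<subseteq> \<sigma>}"
  let ?S2 = "{\<sigma>\<in>universe_fan H. convex_cone hull {w} \<subseteq> \<sigma>}"
  let ?S' = "{\<sigma> \<times> \<sigma>' |\<sigma> \<sigma>'. \<sigma> \<in> ?S1 \<and> \<sigma>' \<in> ?S2}"
  \<comment> \<open>Generators in the product space; a product of cones contains them iff each factor contains its own.\<close>
  define T' where "T' = ?T1 \<times> {0} \<union> {0} \<times> {w}"
  have span_T': "span T' = W'"
    unfolding T'_def by (rule span_Times_axes)
  have T'_subset_iff: "T' \<subseteq> K1 \<times> K2 \<longleftrightarrow> ?T1 \<subseteq> K1 \<and> w \<in> K2" if "0 \<in> K1" "0 \<in> K2" for K1 K2
    using that by (auto simp: T'_def)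
  have hull_iff: "convex_cone hull T \<subseteq> \<tau> \<longleftrightarrow> T \<subseteq> \<tau>" if "convex_cone \<tau>"
    for T and \<tau> :: "'a dvec set"
    using hull_minimal[of T \<tau> convex_cone] hull_subset[of T convex_cone] that by blast
  note slice = convex_cone_causal_slice and cone = convex_cone_nested_cone
  have prod_cone: "convex_cone (nested_cone N \<times> ?K H N')" for N N'
    by (intro convex_cone_Times cone slice)
  have axes: "?T1 \<subseteq> nested_cone N \<longleftrightarrow> f \<in> N" for N by (auto simp: nested_cone_iff)
  have span_K: "x \<in> dspace (A \<union> H)" if "nested G N" "R \<subseteq> N" "x \<in> span (?K G N)" for N x
  proof -
    have "?K G N \<subseteq> dspace (A \<union> H)"
      using nested_subset_A_Un_H[OF that(1,2)] unfolding nested_cone_iff dspace_iff subset_iff Int_iff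
      by blast
    then have "span (?K G N) \<subseteq> dspace (A \<union> H)"
      by (rule span_minimal) (simp add: dspace_def)
    then show ?thesis using that(3) by blast
  qed
  have inj: "x \<in> span {w}" if "nested G N" "R \<subseteq> N" "x \<in> span (?K G N)" "\<Phi> x \<in> span T'" for N x
    using \<Phi>_injective_mod_w[OF span_K[OF that(1-3)]] that(4) by (simp only: span_T')
  have into: "\<Phi> x \<in> span T'" if "x \<in> span {w}" for x
    using \<Phi>_span_w[OF that] by (simp only: span_T')
  have eq: "\<Phi> ` ?K G N + span T' = nested_cone (N \<inter> A) \<times> ?K H (N \<inter> H) + span T'"
    if "nested G N" "R \<subseteq> N" for N
    using \<Phi>_image_causal_slice[OF that] by (simp only: span_T')
  have fwd: "\<exists>\<sigma>'\<in>?S'. \<Phi> ` \<sigma> + W' = \<sigma>' + W'" if \<sigma>: "\<sigma> \<in> ?S0" for \<sigma>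
  proof -
    obtain N where N: "nested G N" and ne: "\<sigma> \<noteq> {}" and face: "\<sigma> face_of ?K G N"
      using \<sigma> by (auto simp: universe_fan_iff)
    have w: "{w} \<subseteq> \<sigma>" using \<sigma> hull_subset[of "{w}" convex_cone] by blast
    then have RN: "R \<subseteq> N"
      using face_of_imp_subset[OF face] w_in_nested_cone_iff[of N] by blast
    let ?N1 = "N \<inter> A" and ?N2 = "N \<inter> H"
    have nested: "nested A ?N1" "nested H ?N2"
      using N A_subset H_subset by (auto intro: nested_of_subset nested_subset)
    have RN2: "R \<subseteq> ?N2" using RN R_subset_H by blast
    have "w \<in> ?K H ?N2" using RN2 by (intro w_in_causal_slice_H) auto
    moreover have "f \<in> ?N1" using RN f_in_R f_in_A by blast
    ultimately have "T' \<subseteq> nested_cone ?N1 \<times> ?K H ?N2"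
      using axes[of ?N1] convex_cone_contains_0[OF cone] convex_cone_contains_0[OF slice]
      by (subst T'_subset_iff) auto
    from face_image_mod_span[OF linear_\<Phi> slice prod_cone eq[OF N RN] into inj[OF N RN] this face ne w]
    obtain \<tau>' where \<tau>': "\<tau>' face_of nested_cone ?N1 \<times> ?K H ?N2" "\<tau>' \<noteq> {}" "T' \<subseteq> \<tau>'"
      "\<Phi> ` \<sigma> + span T' = \<tau>' + span T'" by blast
    then obtain F1 F2 where F: "F1 face_of nested_cone ?N1" "F2 face_of ?K H ?N2" "\<tau>' = F1 \<times> F2"
      by (auto simp: face_of_Times_decomp)
    have ne': "F1 \<noteq> {}" "F2 \<noteq> {}" using \<tau>'(2) F(3) by auto
    have cones: "convex_cone F1" "convex_cone F2"
      using convex_cone_face F(1,2) ne' cone slice by blast+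
    then have sub: "?T1 \<subseteq> F1" "w \<in> F2"
      using \<tau>'(3) F(3) T'_subset_iff[of F1 F2] by (simp_all add: convex_cone_contains_0)
    have "F1 \<in> ?S1"
      using F(1) ne'(1) nested(1) cones(1) sub(1)
      by (auto simp: nested_fan_def nested_complex_def hull_iff)
    moreover have "F2 \<in> ?S2"
      using F(2) ne'(2) nested(2) cones(2) sub(2) by (auto simp: universe_fan_iff hull_iff)
    ultimately have "\<tau>' \<in> ?S'" using F(3) by blast
    then show ?thesis using \<tau>'(4) unfolding span_T' by blast
  qed
  have bwd: "\<exists>\<sigma>\<in>?S0. \<Phi> ` \<sigma> + W' = \<sigma>' + W'" if \<sigma>': "\<sigma>' \<in> ?S'" for \<sigma>'
  proof -
    obtain F1 F2 where F: "F1 \<in> ?S1" "F2 \<in> ?S2" "\<sigma>' = F1 \<times> F2" using \<sigma>' by blast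
    obtain N1 where N1: "nested A N1" "F1 face_of nested_cone N1" "F1 \<noteq> {}"
      using F(1) by (auto simp: nested_fan_def nested_complex_def)
    obtain N2 where N2: "nested H N2" "F2 face_of ?K H N2" "F2 \<noteq> {}"
      using F(2) by (auto simp: universe_fan_iff)
    have sub: "?T1 \<subseteq> F1" "w \<in> F2"
      using F(1,2) hull_subset[of ?T1 convex_cone] hull_subset[of "{w}" convex_cone] by blast+
    have "f \<in> N1" using sub(1) face_of_imp_subset[OF N1(2)] axes[of N1] by blast
    have "R \<subseteq> N2" using sub(2) face_of_imp_subset[OF N2(2)] w_in_nested_cone_iff[of N2] by blast
    define N where "N = N1 \<union> N2"
    have N: "nested G N" unfolding N_def using N1(1) \<open>f \<in> N1\<close> N2(1) by (rule nested_Un)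
    have RN: "R \<subseteq> N" using \<open>R \<subseteq> N2\<close> by (auto simp: N_def)
    have "N1 \<subseteq> A" "N2 \<subseteq> H" using N1(1) N2(1) by (auto simp: nested_def)
    moreover from this have "N2 \<inter> A \<subseteq> {f}" "N1 \<inter> H \<subseteq> {f}" unfolding A_Int_H[symmetric] by auto
    moreover have "f \<in> N2" using \<open>R \<subseteq> N2\<close> f_in_R by auto
    ultimately have Int: "N \<inter> A = N1" "N \<inter> H = N2"
      using \<open>f \<in> N1\<close> unfolding N_def by auto
    have "w \<in> ?K G N" using N by (intro w_in_causal_slice RN) (simp add: nested_def)
    then have w: "{w} \<subseteq> ?K G N" by blast
    have cones: "convex_cone F1" "convex_cone F2"
      using convex_cone_face N1 N2 cone slice by blast+
    have face: "\<sigma>' face_of nested_cone (N \<inter> A) \<times> ?K H (N \<inter> H)"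
      unfolding Int F(3) using N1(2) N2(2) by (rule face_of_Times)
    have ne: "\<sigma>' \<noteq> {}" using N1 N2 F(3) by auto
    have T': "T' \<subseteq> \<sigma>'"
      unfolding F(3) using sub cones by (subst T'_subset_iff) (simp_all add: convex_cone_contains_0)
    from face_preimage_mod_span[OF linear_\<Phi> slice prod_cone eq[OF N RN] into w face ne T']
    obtain \<tau> where \<tau>: "\<tau> face_of ?K G N" "\<tau> \<noteq> {}" "{w} \<subseteq> \<tau>" "\<Phi> ` \<tau> + span T' = \<sigma>' + span T'"
      by blast
    have "\<tau> \<in> ?S0"
      using \<tau>(1-3) N convex_cone_face[OF \<tau>(1) slice \<tau>(2)] by (auto simp: universe_fan_iff hull_iff)
    then show ?thesis using \<tau>(4) unfolding span_T' by blast
  qed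
  have dom: "\<Union>?S0 \<subseteq> dspace (A \<union> H)"
  proof
    fix x assume "x \<in> \<Union>?S0"
    then obtain \<sigma> N where \<sigma>: "x \<in> \<sigma>" "convex_cone hull {w} \<subseteq> \<sigma>" "nested G N" "\<sigma> face_of ?K G N"
      by (auto simp: universe_fan_iff)
    then have sub: "\<sigma> \<subseteq> ?K G N" by (intro face_of_imp_subset)
    have "w \<in> \<sigma>" using \<sigma>(2) hull_subset[of "{w}" convex_cone] by blast
    then have "R \<subseteq> N" using sub w_in_nested_cone_iff[of N] by blast
    moreover have "x \<in> span (?K G N)" using \<sigma>(1) sub by (intro span_base) blast
    ultimately show "x \<in> dspace (A \<union> H)" using span_K[OF \<sigma>(3)] by blast
  qed
  have "fan_isomorphic (span {w}, (\<lambda>\<sigma>. (\<lambda>x. x +o span {w}) ` \<sigma>) ` ?S0)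
      (W', (\<lambda>\<sigma>. (\<lambda>x. x +o W') ` \<sigma>) ` ?S')"
  proof (rule fan_isomorphic_if_linear_correspondence[where \<Phi> = \<Phi> and D = "dspace (A \<union> H)"])
    show "subspace (dspace (A \<union> H))" by (simp add: dspace_def)
    show "subspace W'" by (intro subspace_Times subspace_span)
  qed (fact linear_\<Phi> subspace_span dom \<Phi>_span_w \<Phi>_injective_mod_w fwd bwd)+
  then show ?thesis unfolding link_eq fan_prod_cosets .
qed

end

theorem theorem3p13:
  fixes G R H :: "'a::{finite, bounded_lattice} set" and f :: 'a
  assumes "stable_nestoid G"
    and "causal_region G R f"
    and "H = region_contr G R f \<union> {f}"
  shows "fan_isomorphic
           (link (universe_fan G) {region_vec R f})
           (fan_prod (link (nested_fan (region_restr G R f)) {plus_vec f, minus_vec f})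
                     (link (universe_fan H) {region_vec R f}))"
proof -
  interpret stable_causal_region G R f using assms by unfold_locales
  show ?thesis using universe_fan_link_decomposition by (simp only: A_def H_def assms(3))
qed

end
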